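(* The equational theory of Casari algebras is a conservative extension of the equational theories of commutative integrally closed residuated lattices, sircomonoids, and BCI-algebras. That is: (1) for all terms $s,t$ in the signature $\{\wedge,\vee,\cdot,\backslash,/,\mathrm{e}\}$, the equation $s\approx t$ is valid in all Casari algebras if and only if it is valid in all commutative integrally closed residuated lattices; (2) for all terms $s,t$ in the signature $\{\cdot,\backslash,/,\mathrm{e}\}$, $s\approx t$ is valid in all Casari algebras if and only if it is valid in all sircomonoids; and (3) for all terms $s,t$ in the signature $\{\backslash,/,\mathrm{e}\}$, $s\approx t$ is valid in all Casari algebras if and only if it is valid in all BCI-algebras.
   Context: A residuated lattice is an algebra $\langle A,\wedge,\vee,\cdot,\backslash,/,\mathrm{e}\rangle$ such that $\langle A,\wedge,\vee\rangle$ is a lattice, $\langle A,\cdot,\mathrm{e}\rangle$ is a monoid, and for all $a,b,c\in A$: $b\le a\backslash c \iff ab\le c\iff a\le c/b$. A pointed residuated lattice is a residuated lattice with an extra constant $\mathrm{f}$ (no conditions imposed). A (pointed) residuated lattice is integrally closed if it satisfies $x\backslash x\approx\mathrm{e}$ and $x/x\approx\mathrm{e}$, and commutative if it satisfies $xy\approx yx$; in the commutative case $a\to b$ denotes the common value of $a\backslash b$ and $b/a$. For a commutative pointed residuated lattice let $\lnot a:=a\to\mathrm{f}$; it is involutive if it satisfies $\lnot\lnot x\approx x$. A Casari algebra is an involutive commutative integrally closed pointed residuated lattice satisfying $\mathrm{f}\to\mathrm{e}\approx\mathrm{e}$ (equivalently, $\mathrm{f}\cdot\mathrm{f}\approx\mathrm{f}$).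 A sirmonoid (semi-integral residuated pomonoid) is identified with an algebra $\langle S,\cdot,\backslash,/,\mathrm{e}\rangle$ of type $\langle 2,2,2,0\rangle$ satisfying: (i) $((x\backslash z)/(y\backslash z))/(x\backslash y)\approx\mathrm{e}$; (ii) $(y/x)\backslash((z/y)\backslash(z/x))\approx\mathrm{e}$; (iii) $\mathrm{e}\backslash x\approx x$; (iv) $x/\mathrm{e}\approx x$; (v) $(x\cdot y)\backslash z\approx y\backslash(x\backslash z)$; (vi) $x\backslash y\approx\mathrm{e}\ \&\ y\backslash x\approx\mathrm{e}\Rightarrow x\approx y$. A sircomonoid is a sirmonoid satisfying $x\backslash y\approx y/x$ (or, equivalently, $x\cdot y\approx y\cdot x$). A pseudo BCI-algebra is an algebra $\langle B,\backslash,/,\mathrm{e}\rangle$ of type $\langle2,2,0\rangle$ satisfying (i)–(iv) and (vi); a BCI-algebra is a pseudo BCI-algebra satisfying $x\backslash y\approx y/x$. *)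

theory Defs
  imports "HOL-Algebra.Group"
begin

text \<open>
  The three signatures, and that of pointed residuated lattices, form a chain of record
  extensions. A term of a smaller signature can therefore be evaluated directly in an algebra
  of a larger one, with the additional operations ignored.
\<close>

record 'a div_alg = "'a partial_object" +
  ldiv :: "'a \<Rightarrow> 'a \<Rightarrow> 'a" (infixl "\<setminus>\<index>" 70)
  rdiv :: "'a \<Rightarrow> 'a \<Rightarrow> 'a" (infixl "\<oslash>\<index>" 70)
  neut :: 'a ("\<epsilon>\<index>")

record 'a mult_div_alg = "'a div_alg" +
  times_op :: "'a \<Rightarrow> 'a \<Rightarrow> 'a" (infixl "\<cdot>\<index>" 75)

record 'a lattice_div_alg = "'a mult_div_alg" +
  meet_op :: "'a \<Rightarrow> 'a \<Rightarrow> 'a" (infixl "\<^bold>\<and>\<index>" 65)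
  join_op :: "'a \<Rightarrow> 'a \<Rightarrow> 'a" (infixl "\<^bold>\<or>\<index>" 65)

record 'a pointed_lattice_div_alg = "'a lattice_div_alg" +
  fpoint :: 'a ("\<phi>\<index>")


definition lat_le :: "('a, 'm) lattice_div_alg_scheme \<Rightarrow> 'a \<Rightarrow> 'a \<Rightarrow> bool"
    (infix "\<preceq>\<index>" 50)
  where "a \<preceq>\<^bsub>A\<^esub> b \<longleftrightarrow> a \<^bold>\<and>\<^bsub>A\<^esub> b = a"

locale residuated_lattice =
  fixes A :: "('a, 'm) lattice_div_alg_scheme" (structure)
  assumes monoid: "monoid \<lparr>carrier = carrier A, monoid.mult = times_op A, one = neut A\<rparr>"
    and meet_closed: "\<lbrakk>x \<in> carrier A; y \<in> carrier A\<rbrakk> \<Longrightarrow> x \<^bold>\<and> y \<in> carrier A"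
    and join_closed: "\<lbrakk>x \<in> carrier A; y \<in> carrier A\<rbrakk> \<Longrightarrow> x \<^bold>\<or> y \<in> carrier A"
    and ldiv_closed: "\<lbrakk>x \<in> carrier A; y \<in> carrier A\<rbrakk> \<Longrightarrow> x \<setminus> y \<in> carrier A"
    and rdiv_closed: "\<lbrakk>x \<in> carrier A; y \<in> carrier A\<rbrakk> \<Longrightarrow> x \<oslash> y \<in> carrier A"
    and meet_comm: "\<lbrakk>x \<in> carrier A; y \<in> carrier A\<rbrakk> \<Longrightarrow> x \<^bold>\<and> y = y \<^bold>\<and> x"
    and join_comm: "\<lbrakk>x \<in> carrier A; y \<in> carrier A\<rbrakk> \<Longrightarrow> x \<^bold>\<or> y = y \<^bold>\<or> x"
    and meet_assoc: "\<lbrakk>x \<in> carrier A; y \<in> carrier A; z \<in> carrier A\<rbrakk>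
          \<Longrightarrow> (x \<^bold>\<and> y) \<^bold>\<and> z = x \<^bold>\<and> (y \<^bold>\<and> z)"
    and join_assoc: "\<lbrakk>x \<in> carrier A; y \<in> carrier A; z \<in> carrier A\<rbrakk>
          \<Longrightarrow> (x \<^bold>\<or> y) \<^bold>\<or> z = x \<^bold>\<or> (y \<^bold>\<or> z)"
    and meet_absorb: "\<lbrakk>x \<in> carrier A; y \<in> carrier A\<rbrakk> \<Longrightarrow> x \<^bold>\<and> (x \<^bold>\<or> y) = x"
    and join_absorb: "\<lbrakk>x \<in> carrier A; y \<in> carrier A\<rbrakk> \<Longrightarrow> x \<^bold>\<or> (x \<^bold>\<and> y) = x"
    and residual_left: "\<lbrakk>a \<in> carrier A; b \<in> carrier A; c \<in> carrier A\<rbrakk>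
          \<Longrightarrow> b \<preceq> a \<setminus> c \<longleftrightarrow> a \<cdot> b \<preceq> c"
    and residual_right: "\<lbrakk>a \<in> carrier A; b \<in> carrier A; c \<in> carrier A\<rbrakk>
          \<Longrightarrow> a \<cdot> b \<preceq> c \<longleftrightarrow> a \<preceq> c \<oslash> b"

locale integrally_closed_residuated_lattice = residuated_lattice +
  assumes ldiv_self: "x \<in> carrier A \<Longrightarrow> x \<setminus> x = \<epsilon>"
    and rdiv_self: "x \<in> carrier A \<Longrightarrow> x \<oslash> x = \<epsilon>"

locale comm_integrally_closed_residuated_lattice = integrally_closed_residuated_lattice +
  assumes times_comm: "\<lbrakk>x \<in> carrier A; y \<in> carrier A\<rbrakk> \<Longrightarrow> x \<cdot> y = y \<cdot> x"

locale pointed_residuated_lattice =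
  residuated_lattice A for A :: "('a, 'm) pointed_lattice_div_alg_scheme" (structure) +
  assumes fpoint_closed: "\<phi> \<in> carrier A"

text \<open>In the commutative case \<open>a \<rightarrow> b\<close> is the common value of \<open>a \<setminus> b\<close> and \<open>b \<oslash> a\<close>.\<close>

definition neg :: "('a, 'm) pointed_lattice_div_alg_scheme \<Rightarrow> 'a \<Rightarrow> 'a"
  where "neg A a = a \<setminus>\<^bsub>A\<^esub> \<phi>\<^bsub>A\<^esub>"

locale casari_algebra =
  pointed_residuated_lattice A + comm_integrally_closed_residuated_lattice A
    for A :: "('a, 'm) pointed_lattice_div_alg_scheme" (structure) +
  assumes involutive: "x \<in> carrier A \<Longrightarrow> neg A (neg A x) = x"
    and fpoint_ldiv_neut: "\<phi> \<setminus> \<epsilon> = \<epsilon>"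


locale pseudo_bci_algebra =
  fixes A :: "('a, 'm) div_alg_scheme" (structure)
  assumes neut_closed: "\<epsilon> \<in> carrier A"
    and ldiv_closed: "\<lbrakk>x \<in> carrier A; y \<in> carrier A\<rbrakk> \<Longrightarrow> x \<setminus> y \<in> carrier A"
    and rdiv_closed: "\<lbrakk>x \<in> carrier A; y \<in> carrier A\<rbrakk> \<Longrightarrow> x \<oslash> y \<in> carrier A"
    and ldiv_trans: "\<lbrakk>x \<in> carrier A; y \<in> carrier A; z \<in> carrier A\<rbrakk>
          \<Longrightarrow> ((x \<setminus> z) \<oslash> (y \<setminus> z)) \<oslash> (x \<setminus> y) = \<epsilon>"
    and rdiv_trans: "\<lbrakk>x \<in> carrier A; y \<in> carrier A; z \<in> carrier A\<rbrakk>
          \<Longrightarrow> (y \<oslash> x) \<setminus> ((z \<oslash> y) \<setminus> (z \<oslash> x)) = \<epsilon>"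
    and neut_ldiv: "x \<in> carrier A \<Longrightarrow> \<epsilon> \<setminus> x = x"
    and rdiv_neut: "x \<in> carrier A \<Longrightarrow> x \<oslash> \<epsilon> = x"
    and antisym: "\<lbrakk>x \<in> carrier A; y \<in> carrier A; x \<setminus> y = \<epsilon>; y \<setminus> x = \<epsilon>\<rbrakk> \<Longrightarrow> x = y"

locale bci_algebra = pseudo_bci_algebra +
  assumes ldiv_eq_rdiv: "\<lbrakk>x \<in> carrier A; y \<in> carrier A\<rbrakk> \<Longrightarrow> x \<setminus> y = y \<oslash> x"

locale sirmonoid =
  pseudo_bci_algebra A for A :: "('a, 'm) mult_div_alg_scheme" (structure) +
  assumes times_closed: "\<lbrakk>x \<in> carrier A; y \<in> carrier A\<rbrakk> \<Longrightarrow> x \<cdot> y \<in> carrier A"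
    and times_ldiv: "\<lbrakk>x \<in> carrier A; y \<in> carrier A; z \<in> carrier A\<rbrakk>
          \<Longrightarrow> (x \<cdot> y) \<setminus> z = y \<setminus> (x \<setminus> z)"

locale sircomonoid = sirmonoid +
  assumes ldiv_eq_rdiv: "\<lbrakk>x \<in> carrier A; y \<in> carrier A\<rbrakk> \<Longrightarrow> x \<setminus> y = y \<oslash> x"


datatype div_term =
    DVar nat
  | DNeut
  | DLdiv div_term div_term
  | DRdiv div_term div_term

datatype mult_div_term =
    MVar nat
  | MNeut
  | MLdiv mult_div_term mult_div_term
  | MRdiv mult_div_term mult_div_term
  | MTimes mult_div_term mult_div_term

datatype lattice_div_term =
    LVar nat
  | LNeut
  | LLdiv lattice_div_term lattice_div_term
  | LRdiv lattice_div_term lattice_div_term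
  | LTimes lattice_div_term lattice_div_term
  | LMeet lattice_div_term lattice_div_term
  | LJoin lattice_div_term lattice_div_term

primrec div_eval :: "('a, 'm) div_alg_scheme \<Rightarrow> (nat \<Rightarrow> 'a) \<Rightarrow> div_term \<Rightarrow> 'a" where
  "div_eval A v (DVar n) = v n"
| "div_eval A v DNeut = \<epsilon>\<^bsub>A\<^esub>"
| "div_eval A v (DLdiv s t) = div_eval A v s \<setminus>\<^bsub>A\<^esub> div_eval A v t"
| "div_eval A v (DRdiv s t) = div_eval A v s \<oslash>\<^bsub>A\<^esub> div_eval A v t"

primrec mult_div_eval ::
  "('a, 'm) mult_div_alg_scheme \<Rightarrow> (nat \<Rightarrow> 'a) \<Rightarrow> mult_div_term \<Rightarrow> 'a" where
  "mult_div_eval A v (MVar n) = v n"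
| "mult_div_eval A v MNeut = \<epsilon>\<^bsub>A\<^esub>"
| "mult_div_eval A v (MLdiv s t) = mult_div_eval A v s \<setminus>\<^bsub>A\<^esub> mult_div_eval A v t"
| "mult_div_eval A v (MRdiv s t) = mult_div_eval A v s \<oslash>\<^bsub>A\<^esub> mult_div_eval A v t"
| "mult_div_eval A v (MTimes s t) = mult_div_eval A v s \<cdot>\<^bsub>A\<^esub> mult_div_eval A v t"

primrec lattice_div_eval ::
  "('a, 'm) lattice_div_alg_scheme \<Rightarrow> (nat \<Rightarrow> 'a) \<Rightarrow> lattice_div_term \<Rightarrow> 'a" where
  "lattice_div_eval A v (LVar n) = v n"
| "lattice_div_eval A v LNeut = \<epsilon>\<^bsub>A\<^esub>"
| "lattice_div_eval A v (LLdiv s t) = lattice_div_eval A v s \<setminus>\<^bsub>A\<^esub> lattice_div_eval A v t"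
| "lattice_div_eval A v (LRdiv s t) = lattice_div_eval A v s \<oslash>\<^bsub>A\<^esub> lattice_div_eval A v t"
| "lattice_div_eval A v (LTimes s t) = lattice_div_eval A v s \<cdot>\<^bsub>A\<^esub> lattice_div_eval A v t"
| "lattice_div_eval A v (LMeet s t) = lattice_div_eval A v s \<^bold>\<and>\<^bsub>A\<^esub> lattice_div_eval A v t"
| "lattice_div_eval A v (LJoin s t) = lattice_div_eval A v s \<^bold>\<or>\<^bsub>A\<^esub> lattice_div_eval A v t"

definition div_valid :: "('a, 'm) div_alg_scheme \<Rightarrow> div_term \<Rightarrow> div_term \<Rightarrow> bool"
  where "div_valid A s t \<longleftrightarrow>
    (\<forall>v. range v \<subseteq> carrier A \<longrightarrow> div_eval A v s = div_eval A v t)"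

definition mult_div_valid ::
  "('a, 'm) mult_div_alg_scheme \<Rightarrow> mult_div_term \<Rightarrow> mult_div_term \<Rightarrow> bool"
  where "mult_div_valid A s t \<longleftrightarrow>
    (\<forall>v. range v \<subseteq> carrier A \<longrightarrow> mult_div_eval A v s = mult_div_eval A v t)"

definition lattice_div_valid ::
  "('a, 'm) lattice_div_alg_scheme \<Rightarrow> lattice_div_term \<Rightarrow> lattice_div_term \<Rightarrow> bool"
  where "lattice_div_valid A s t \<longleftrightarrow>
    (\<forall>v. range v \<subseteq> carrier A \<longrightarrow> lattice_div_eval A v s = lattice_div_eval A v t)"

text \<open>
  HOL cannot quantify over types inside a formula, so ``all algebras of a class'' is read as all
  algebras whose carrier is a subset of a given type, where that type is an arbitrary infinite one
  (types with too few elements would only see some of the algebras). The four types below, one for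
  each class of algebras, are independent type variables, so that every algebra of every
  cardinality is covered by some instance.
\<close>

end

theory Submission
  imports Defs "HOL-Library.Multiset_Order" "HOL-Library.Product_Plus" "HOL-Library.Countable_Set"
begin

text \<open>
  The degree of an element is its image under double negation, which takes values in an abelian
  \<open>\<ell>\<close>-group. Consider formal products of elements \<open>G\<close> of a given algebra and of negations of elements
  \<open>D\<close>, and let the pole consist of those lying below \<open>f\<close>: for a single negation \<open>d\<close> this means
  \<open>G \<le> d\<close>, for two or more negations only degrees are compared, and without negations it never
  happens. The sets closed under the induced polarity that contain an element of greatest degree
  form a Casari algebra: \<open>X \<setminus> X\<close> is the set of elements of nonpositive degree, because
  \<open>w + X \<subseteq> X\<close> cannot increase the greatest degree, and these elements are exactly the ones below the
  unit, because in an integrally closed algebra \<open>x\<close> is below the unit as soon as its double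
  negation is.

  For residuated lattices this applies directly. A BCI-algebra or sircomonoid need not have
  torsion-free degrees, so there the degree of a term is taken in the free abelian group on the
  variables instead, under a total order, and a strict inequality of degrees counts as an
  inequality of terms. The Glivenko property (a term of degree 0 is below the unit) is then what
  makes the construction work.
\<close>

section \<open>Casari algebras from polarities with degrees\<close>

text \<open>
  The preorder compares degrees. The point \<open>z\<close> has degree 0, and adding it to an element leaves
  only the degree, so \<open>v + z\<close> lies in every closed set that has an element of degree at least that
  of \<open>v\<close>.
\<close>

locale casari_frame =
  fixes P :: "'w::comm_monoid_add set"
    and le :: "'w \<Rightarrow> 'w \<Rightarrow> bool" (infix "\<lesssim>" 50)
    and z :: 'w
  assumes le_refl: "x \<lesssim> x"
    and le_trans: "x \<lesssim> y \<Longrightarrow> y \<lesssim> u \<Longrightarrow> x \<lesssim> u"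
    and le_add: "x \<lesssim> y \<Longrightarrow> x + u \<lesssim> y + u"
    and inverse_ex: "\<exists>y. x + y \<lesssim> 0 \<and> 0 \<lesssim> x + y"
    and meet_ex: "\<exists>m. m \<lesssim> x \<and> m \<lesssim> y \<and> (\<forall>u. u \<lesssim> x \<longrightarrow> u \<lesssim> y \<longrightarrow> u \<lesssim> m)"
    and pole_le: "x \<in> P \<Longrightarrow> x \<lesssim> 0"
    and pole_absorb: "x \<in> P \<Longrightarrow> y \<lesssim> 0 \<Longrightarrow> x + y \<in> P"
    and add_z_pole: "x + z \<in> P \<longleftrightarrow> x \<lesssim> 0"
    and z_ge: "0 \<lesssim> z"
begin

definition perp :: "'w set \<Rightarrow> 'w set" where "perp X = {w. \<forall>x\<in>X. w + x \<in> P}"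

definition setadd :: "'w set \<Rightarrow> 'w set \<Rightarrow> 'w set" where
  "setadd X Y = {x + y |x y. x \<in> X \<and> y \<in> Y}"

definition residual :: "'w set \<Rightarrow> 'w set \<Rightarrow> 'w set" where
  "residual X Y = {w. \<forall>x\<in>X. w + x \<in> Y}"

definition graded :: "'w set \<Rightarrow> bool" where
  "graded X \<longleftrightarrow> perp (perp X) = X \<and> (\<exists>w\<in>X. \<forall>x\<in>X. x \<lesssim> w)"

text \<open>The neutral element is the closure of \<open>{0}\<close>, by \<open>perp_zero\<close>
  and \<open>perp_pole\<close>, and the join is the closure of the union, by \<open>perp_Un\<close>.
  Addition is commutative, so both divisions are the same residual.\<close>

definition frame_alg :: "'w set pointed_lattice_div_alg" where
  "frame_alg = \<lparr>carrier = {X. graded X}, ldiv = residual, rdiv = (\<lambda>Y X. residual X Y),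
     neut = {w. w \<lesssim> 0}, times_op = (\<lambda>X Y. perp (perp (setadd X Y))),
     meet_op = (\<inter>), join_op = (\<lambda>X Y. perp (perp X \<inter> perp Y)), fpoint = P\<rparr>"

lemma gradedE:
  assumes "graded X"
  obtains w where "w \<in> X" "\<And>x. x \<in> X \<Longrightarrow> x \<lesssim> w"
  using assms unfolding graded_def by (elim conjE bexE) simp

lemma le_add2: "x \<lesssim> y \<Longrightarrow> u \<lesssim> v \<Longrightarrow> x + u \<lesssim> y + v"
  by (metis add.commute le_add le_trans)

lemma le_cancel: "x + u \<lesssim> y + u \<Longrightarrow> x \<lesssim> y"
proof -
  assume a: "x + u \<lesssim> y + u"
  obtain v where v: "u + v \<lesssim> 0" "0 \<lesssim> u + v" using inverse_ex by blast
  have "x + 0 \<lesssim> x + (u + v)" using le_add2 le_refl v by blast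
  moreover have "x + (u + v) \<lesssim> y + (u + v)" using le_add[OF a, of v] by (simp add: add.assoc)
  moreover have "y + (u + v) \<lesssim> y + 0" using le_add2 le_refl v by blast
  ultimately have "x + 0 \<lesssim> y + 0" using le_trans by blast
  then show ?thesis by simp
qed

section \<open>The polarity and its closure operator\<close>

lemma perp_antimono: "X \<subseteq> Y \<Longrightarrow> perp Y \<subseteq> perp X"
  by (auto simp: perp_def)

lemma subset_perp_iff: "X \<subseteq> perp Y \<longleftrightarrow> Y \<subseteq> perp X"
proof -
  have "X \<subseteq> perp Y \<longleftrightarrow> (\<forall>x\<in>X. \<forall>y\<in>Y. x + y \<in> P)" for X Y
    by (auto simp: perp_def)
  then show ?thesis by (metis (no_types, lifting) add.commute)
qed

lemma perp_perp_ge: "X \<subseteq> perp (perp X)"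
  using subset_perp_iff by blast

lemma perp_perp_perp [simp]: "perp (perp (perp X)) = perp X"
  by (simp add: perp_antimono perp_perp_ge subset_antisym)

lemma residual_perp: "residual X (perp Y) = perp (setadd X Y)"
  by (fastforce simp: residual_def perp_def setadd_def add.assoc)

lemma subset_residual_iff: "X \<subseteq> residual Y Z \<longleftrightarrow> setadd X Y \<subseteq> Z"
  by (fastforce simp: residual_def setadd_def)

lemma setadd_commute: "setadd X Y = setadd Y X"
  by (auto simp: setadd_def) (metis add.commute)+

lemma setadd_assoc: "setadd (setadd X Y) U = setadd X (setadd Y U)"
  apply (auto simp: setadd_def add.assoc)
   apply blast
  by (metis add.assoc)

lemma closure_least: "X \<subseteq> perp Y \<Longrightarrow> perp (perp X) \<subseteq> perp Y"
  by (metis perp_antimono perp_perp_perp)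

text \<open>A residual into a closed set is itself closed by \<open>residual_perp\<close>, so it
  contains a set as soon as it contains a generating subset. This makes the closure compatible with
  products.\<close>

lemma perp_setadd_closure: "perp (setadd (perp (perp X)) Y) = perp (setadd X Y)"
proof
  show "perp (setadd (perp (perp X)) Y) \<subseteq> perp (setadd X Y)"
    by (rule perp_antimono) (use perp_perp_ge in \<open>auto simp: setadd_def\<close>)
  have "setadd X Y \<subseteq> perp (perp (setadd X Y))" by (rule perp_perp_ge)
  then have "X \<subseteq> residual Y (perp (perp (setadd X Y)))" by (simp add: subset_residual_iff)
  then have "perp (perp X) \<subseteq> residual Y (perp (perp (setadd X Y)))"
    unfolding residual_perp by (rule closure_least)
  then show "perp (setadd X Y) \<subseteq> perp (setadd (perp (perp X)) Y)"
    by (metis subset_residual_iff subset_perp_iff)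
qed

lemma perp_setadd_closure2: "perp (setadd X (perp (perp Y))) = perp (setadd X Y)"
  by (metis perp_setadd_closure setadd_commute)

lemma residual_closure: "residual (perp (perp X)) (perp Y) = perp (setadd X Y)"
  by (simp add: residual_perp perp_setadd_closure)

section \<open>Closed sets with an element of greatest degree\<close>

lemma graded_down:
  assumes "perp (perp X) = X" "w \<in> X" "v \<lesssim> w"
  shows "v + z \<in> X"
proof -
  have "y + (v + z) \<in> P" if "y \<in> perp X" for y
  proof -
    have "y + w \<in> P" using that assms(2) by (auto simp: perp_def)
    then have "y + v \<lesssim> 0" using pole_le le_add2[OF le_refl assms(3)] le_trans by blast
    then show ?thesis using add_z_pole[of "y + v"] by (simp add: add.assoc)
  qed
  then have "v + z \<in> perp (perp X)" by (auto simp: perp_def add.commute)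
  then show ?thesis using assms by simp
qed

text \<open>If \<open>v\<close> inverts the bound \<open>w\<close>, then \<open>v + z\<close> lies
  in \<open>perp Z\<close>. Testing the closure against this one element shows that it respects the
  same bound, which \<open>w'\<close> attains.\<close>

lemma gradedI:
  assumes "Z \<subseteq> {x. x \<lesssim> w}" "w' \<in> perp (perp Z)" "w \<lesssim> w'"
  shows "graded (perp (perp Z))"
proof -
  obtain v where v: "w + v \<lesssim> 0" "0 \<lesssim> w + v" using inverse_ex by blast
  have "x + (v + z) \<in> P" if "x \<in> Z" for x
  proof -
    have "x + v \<lesssim> 0" using that assms(1) le_add[of x w v] v(1) le_trans by blast
    then show ?thesis using add_z_pole[of "x + v"] by (simp add: add.assoc)
  qed
  then have vz: "v + z \<in> perp Z" by (auto simp: perp_def add.commute)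
  have "x \<lesssim> w'" if "x \<in> perp (perp Z)" for x
  proof -
    have "x + (v + z) \<in> P" using that vz by (auto simp: perp_def)
    then have "x + v \<lesssim> 0" using add_z_pole[of "x + v"] by (simp add: add.assoc)
    then have "x + v \<lesssim> w + v" using v le_trans by blast
    then show ?thesis using le_cancel assms(3) le_trans by blast
  qed
  then show ?thesis using assms(2) unfolding graded_def by (intro conjI bexI[of _ w'] ballI) simp_all
qed

text \<open>The greatest degree in \<open>perp X\<close> is the inverse of the one in
  \<open>X\<close>, attained at \<open>v + z\<close>.\<close>

lemma graded_perp: assumes "graded X" shows "graded (perp X)"
proof -
  obtain w where w: "w \<in> X" "\<And>x. x \<in> X \<Longrightarrow> x \<lesssim> w" using assms gradedE by metis
  obtain v where v: "w + v \<lesssim> 0" "0 \<lesssim> w + v" using inverse_ex by blast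
  have le: "v \<lesssim> v + z" using le_add2[OF le_refl z_ge] by (metis add.right_neutral)
  have "v + z \<in> perp X"
  proof -
    have "v + z + x \<in> P" if "x \<in> X" for x
    proof -
      have "x + v \<lesssim> 0" using w(2)[OF that] le_add[of x w v] v(1) le_trans by blast
      then show ?thesis using add_z_pole[of "x + v"] by (simp add: ac_simps)
    qed
    then show ?thesis by (simp add: perp_def)
  qed
  moreover have "y \<lesssim> v" if "y \<in> perp X" for y
  proof -
    have "y + w \<lesssim> 0" using that w(1) pole_le by (auto simp: perp_def)
    then have "y + w \<lesssim> v + w" using v le_trans by (metis add.commute)
    then show ?thesis using le_cancel by blast
  qed
  ultimately have "graded (perp (perp (perp X)))" by (intro gradedI[OF _ _ le]) auto
  then show ?thesis by simp
qed

text \<open>The greatest degree is the meet \<open>m\<close> of the two given ones;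
  \<open>graded_down\<close> places \<open>m + z\<close> in both sets.\<close>

lemma graded_inter: assumes "graded X" "graded Y" shows "graded (X \<inter> Y)"
proof -
  obtain w where w: "w \<in> X" "\<And>x. x \<in> X \<Longrightarrow> x \<lesssim> w" using assms gradedE by metis
  obtain v where v: "v \<in> Y" "\<And>x. x \<in> Y \<Longrightarrow> x \<lesssim> v" using assms gradedE by metis
  obtain m where m: "m \<lesssim> w" "m \<lesssim> v" "\<And>u. u \<lesssim> w \<Longrightarrow> u \<lesssim> v \<Longrightarrow> u \<lesssim> m"
    using meet_ex[of w v] by blast
  have le: "m \<lesssim> m + z" using le_add2[OF le_refl z_ge] by (metis add.right_neutral)
  have "perp (perp (X \<inter> Y)) \<subseteq> X \<inter> Y"
    using closure_least[of "X \<inter> Y" "perp X"] closure_least[of "X \<inter> Y" "perp Y"] assms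
    unfolding graded_def by (metis Int_greatest Int_lower1 Int_lower2 closure_least)
  moreover have "m + z \<in> X \<inter> Y" using graded_down assms w v m unfolding graded_def by simp
  moreover have "x \<lesssim> m + z" if "x \<in> X \<inter> Y" for x
    using that w(2) v(2) m(3) le_trans[OF _ le] by blast
  ultimately show ?thesis unfolding graded_def
    by (intro conjI bexI[of _ "m + z"] ballI equalityI perp_perp_ge) simp_all
qed

lemma graded_times: assumes "graded X" "graded Y" shows "graded (perp (perp (setadd X Y)))"
proof -
  obtain w where w: "w \<in> X" "\<And>x. x \<in> X \<Longrightarrow> x \<lesssim> w" using assms gradedE by metis
  obtain v where v: "v \<in> Y" "\<And>x. x \<in> Y \<Longrightarrow> x \<lesssim> v" using assms gradedE by metis
  have "w + v \<in> setadd X Y" using w v by (auto simp: setadd_def)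
  then have "w + v \<in> perp (perp (setadd X Y))" using perp_perp_ge by blast
  moreover have "setadd X Y \<subseteq> {x. x \<lesssim> w + v}" using le_add2 w v by (auto simp: setadd_def)
  ultimately show ?thesis using gradedI le_refl by blast
qed

lemma residual_graded: "graded Y \<Longrightarrow> residual X Y = perp (setadd X (perp Y))"
  by (metis graded_def residual_perp)

lemma graded_residual: "graded X \<Longrightarrow> graded Y \<Longrightarrow> graded (residual X Y)"
  by (metis graded_perp graded_times perp_perp_perp residual_graded)

section \<open>The unit, the point and the Casari equations\<close>

lemma residual_pole: "residual X P = perp X"
  by (auto simp: residual_def perp_def)

lemma z_pole: "z \<in> P" and z_le: "z \<lesssim> 0"
  using add_z_pole[of 0] le_refl pole_le by auto

lemma perp_zero: "perp {0} = P" by (auto simp: perp_def)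

text \<open>The single test element \<open>z\<close> of the pole bounds the degree, and
  \<open>pole_absorb\<close> is exactly the converse.\<close>

lemma perp_pole: "perp P = {w. w \<lesssim> 0}"
proof -
  have "w \<lesssim> 0" if "w \<in> perp P" for w
    using that z_pole add_z_pole[of w] by (auto simp: perp_def)
  moreover have "w + x \<in> P" if "w \<lesssim> 0" "x \<in> P" for w x
    using pole_absorb[OF that(2,1)] by (simp add: add.commute)
  ultimately show ?thesis by (auto simp: perp_def)
qed

lemma graded_zero: "graded {w. w \<lesssim> 0}"
  using gradedI[of "{0}" 0 0] le_refl by (simp add: perp_zero perp_pole)

lemma graded_pole: "graded P"
  using graded_perp[OF graded_zero] by (metis perp_perp_perp perp_zero perp_pole)

lemma times_neut: "graded X \<Longrightarrow> perp (perp (setadd {w. w \<lesssim> 0} X)) = X"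
proof -
  assume "graded X"
  have "perp (setadd {w. w \<lesssim> 0} X) = perp (setadd {0} X)"
    by (metis perp_setadd_closure perp_zero perp_pole)
  moreover have "setadd {0} X = X" by (auto simp: setadd_def)
  ultimately show ?thesis using \<open>graded X\<close> by (simp add: graded_def)
qed

text \<open>If \<open>w\<close> maps \<open>X\<close> into itself, compare \<open>w + v\<close> with
  the greatest \<open>v\<close> and cancel. The other inclusion is the unit law read through
  residuation.\<close>

lemma residual_self: assumes "graded X" shows "residual X X = {w. w \<lesssim> 0}"
proof -
  obtain v where v: "v \<in> X" "\<And>x. x \<in> X \<Longrightarrow> x \<lesssim> v" using assms gradedE by metis
  have "w \<lesssim> 0" if "w \<in> residual X X" for w
    using that v le_cancel[of w v 0] by (auto simp: residual_def)
  moreover have "{w. w \<lesssim> 0} \<subseteq> residual X X"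
    using times_neut[OF assms] perp_perp_ge subset_residual_iff by metis
  ultimately show ?thesis by blast
qed

lemma perp_Un: "perp (X \<union> Y) = perp X \<inter> perp Y"
  by (auto simp: perp_def)

text \<open>The pole consists of elements of nonpositive degree and contains \<open>z\<close>, whose
  degree is 0; so division by the pole does not change the degree bound.\<close>

lemma residual_pole_neut: "residual P {w. w \<lesssim> 0} = {w. w \<lesssim> 0}"
proof -
  have "w \<lesssim> 0" if "w + z \<lesssim> 0" for w
  proof -
    have "w + 0 \<lesssim> w + z" using le_refl z_ge by (rule le_add2)
    then show ?thesis using that le_trans by auto
  qed
  then have "residual P {w. w \<lesssim> 0} \<subseteq> {w. w \<lesssim> 0}"
    using z_pole unfolding residual_def by blast
  moreover have "w + x \<lesssim> 0" if "w \<lesssim> 0" "x \<in> P" for w x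
    using that pole_le le_add2[of w 0 x 0] by simp
  then have "{w. w \<lesssim> 0} \<subseteq> residual P {w. w \<lesssim> 0}"
    unfolding residual_def by blast
  ultimately show ?thesis by (rule equalityI)
qed

lemma closure_subset_iff: "graded Y \<Longrightarrow> perp (perp X) \<subseteq> Y \<longleftrightarrow> X \<subseteq> Y"
  by (metis closure_least graded_def perp_perp_ge subset_trans)

lemma frame_lat_le: "lat_le frame_alg X Y \<longleftrightarrow> X \<subseteq> Y"
  by (simp add: lat_le_def frame_alg_def Int_absorb2 inf.absorb_iff1)

lemma perp_closure_inter: "perp (perp (perp X \<inter> perp Y)) = perp X \<inter> perp Y"
  by (metis Un_Int_eq perp_Un perp_perp_perp)

text \<open>Negation is \<open>perp\<close>, by \<open>residual_pole\<close>, so involutivity is the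
  closedness of graded sets. Integral closure is \<open>residual_self\<close>.\<close>

lemma casari_frame_alg: "casari_algebra frame_alg"
proof -
  have monoid: "monoid \<lparr>carrier = {X. graded X}, monoid.mult = (\<lambda>X Y. perp (perp (setadd X Y))),
      one = {w. w \<lesssim> 0}\<rparr>"
  proof (rule monoidI, unfold partial_object.simps monoid.simps mem_Collect_eq)
    fix X assume X: "graded X"
    show "perp (perp (setadd X {w. w \<lesssim> 0})) = X"
      by (subst setadd_commute) (rule times_neut[OF X])
  qed (simp_all only: graded_times graded_zero times_neut perp_setadd_closure
        perp_setadd_closure2 setadd_assoc)
  have cl: "perp (perp X) = X" if "graded X" for X using that unfolding graded_def by blast
  have join_graded: "graded (perp (perp X \<inter> perp Y))" if "graded X" "graded Y" for X Y
    using that by (intro graded_perp graded_inter)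
  have "residuated_lattice frame_alg"
  proof (rule residuated_lattice.intro)
    fix X Y assume "X \<in> carrier frame_alg" "Y \<in> carrier frame_alg"
    then have XY: "graded X" "graded Y" by (simp_all add: frame_alg_def)
    show "X \<^bold>\<and>\<^bsub>frame_alg\<^esub> (X \<^bold>\<or>\<^bsub>frame_alg\<^esub> Y) = X"
      using perp_antimono[of "perp X \<inter> perp Y" "perp X"] XY cl by (simp add: frame_alg_def) blast
    have "perp X \<subseteq> perp (X \<inter> Y)" by (rule perp_antimono) simp
    then have "perp X \<inter> perp (X \<inter> Y) = perp X" by blast
    then show "X \<^bold>\<or>\<^bsub>frame_alg\<^esub> (X \<^bold>\<and>\<^bsub>frame_alg\<^esub> Y) = X"
      using XY cl by (simp add: frame_alg_def)
  next
    fix X Y U assume "X \<in> carrier frame_alg" "Y \<in> carrier frame_alg" "U \<in> carrier frame_alg"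
    then have XY: "graded X" "graded Y" "graded U" by (simp_all add: frame_alg_def)
    show "Y \<preceq>\<^bsub>frame_alg\<^esub> X \<setminus>\<^bsub>frame_alg\<^esub> U \<longleftrightarrow> X \<cdot>\<^bsub>frame_alg\<^esub> Y \<preceq>\<^bsub>frame_alg\<^esub> U"
      "X \<cdot>\<^bsub>frame_alg\<^esub> Y \<preceq>\<^bsub>frame_alg\<^esub> U \<longleftrightarrow> X \<preceq>\<^bsub>frame_alg\<^esub> U \<oslash>\<^bsub>frame_alg\<^esub> Y"
      unfolding frame_lat_le using XY
      by (simp_all add: frame_alg_def subset_residual_iff closure_subset_iff setadd_commute[of X Y])
  qed (simp_all add: frame_alg_def graded_inter join_graded graded_residual Int_ac perp_closure_inter
       monoid)
  then interpret residuated_lattice frame_alg .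
  show ?thesis
    by unfold_locales (simp_all add: frame_alg_def graded_pole residual_self setadd_commute
       neg_def residual_pole cl residual_pole_neut)
qed

end

section \<open>Polarities from sequents\<close>

text \<open>
  A pair \<open>(G, D)\<close> stands for the product of the terms in \<open>G\<close> and of the negations of the terms
  in \<open>D\<close>; \<open>\<turnstile>\<close> is derivability and \<open>\<sqsubseteq>\<close> compares the degrees of products.
\<close>

locale sequent_frame =
  fixes ded :: "'t multiset \<Rightarrow> 't \<Rightarrow> bool" (infix "\<turnstile>" 50)
    and dle :: "'t multiset \<Rightarrow> 't multiset \<Rightarrow> bool" (infix "\<sqsubseteq>" 50)
  assumes dle_refl: "G \<sqsubseteq> G"
    and dle_add: "G \<sqsubseteq> D \<Longrightarrow> G' \<sqsubseteq> D' \<Longrightarrow> G + G' \<sqsubseteq> D + D'"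
    and dle_cancel: "G + H \<sqsubseteq> D + H \<Longrightarrow> G \<sqsubseteq> D"
    and dle_meet: "\<exists>F. F \<sqsubseteq> G \<and> F \<sqsubseteq> D \<and> (\<forall>H K. H \<sqsubseteq> G + K \<longrightarrow> H \<sqsubseteq> D + K \<longrightarrow> H \<sqsubseteq> F + K)"
    and weaken: "G \<turnstile> t \<Longrightarrow> H \<sqsubseteq> {#} \<Longrightarrow> G + H \<turnstile> t"
    and ded_dle: "G \<turnstile> t \<Longrightarrow> G \<sqsubseteq> {#t#}"
    and ded_refl: "{#t#} \<turnstile> t"
    and cut: "G \<turnstile> s \<Longrightarrow> D + {#s#} \<turnstile> t \<Longrightarrow> G + D \<turnstile> t"
begin

definition pole :: "('t multiset \<times> 't multiset) set" where
  "pole = {(G, D). (\<exists>t. D = {#t#} \<and> G \<turnstile> t) \<or> (2 \<le> size D \<and> G \<sqsubseteq> D)}"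

text \<open>The degree of a pair is that of its first component minus that of its second; the
  subtracted parts are moved across.\<close>

definition le :: "'t multiset \<times> 't multiset \<Rightarrow> 't multiset \<times> 't multiset \<Rightarrow> bool" where
  "le x y \<longleftrightarrow> fst x + snd y \<sqsubseteq> fst y + snd x"

text \<open>Equal components give degree 0, and the two negations force every sum with this point
  into the case of \<open>pole\<close> where only degrees count.\<close>

abbreviation zero_point :: "'t multiset \<times> 't multiset" where
  "zero_point \<equiv> ({#undefined, undefined#}, {#undefined, undefined#})"

lemma dle_cancel_iff: "G + H \<sqsubseteq> D + H \<longleftrightarrow> G \<sqsubseteq> D"
  using dle_cancel dle_add dle_refl by blast

lemma dle_trans: "G \<sqsubseteq> D \<Longrightarrow> D \<sqsubseteq> H \<Longrightarrow> G \<sqsubseteq> H"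
  using dle_add[of G D D H] dle_cancel[of G D H] by (simp add: add.commute)

lemma le_zero_iff: "le (G, D) 0 \<longleftrightarrow> G \<sqsubseteq> D"
  by (simp add: le_def zero_prod_def)

lemma pole_singleton [simp]: "(G, {#t#}) \<in> pole \<longleftrightarrow> G \<turnstile> t"
  by (simp add: pole_def)

lemma pole_empty [simp]: "(G, {#}) \<notin> pole"
  by (simp add: pole_def)

lemma pole_add_mset: "D \<noteq> {#} \<Longrightarrow> (G, add_mset t D) \<in> pole \<longleftrightarrow> G \<sqsubseteq> add_mset t D"
  by (auto simp: pole_def Suc_le_eq nonempty_has_size)

text \<open>The meet of two differences is formed over the common subtrahend \<open>D + D'\<close>.
  The extra summand \<open>K\<close> in \<open>dle_meet\<close> is the subtracted part of the
  element compared with it.\<close>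

lemma le_meet_ex: "\<exists>m. le m x \<and> le m y \<and> (\<forall>u. le u x \<longrightarrow> le u y \<longrightarrow> le u m)"
proof -
  obtain G D G' D' where xy: "x = (G, D)" "y = (G', D')" by (metis prod.exhaust)
  obtain F where F: "F \<sqsubseteq> G + D'" "F \<sqsubseteq> G' + D"
    "\<And>H K. H \<sqsubseteq> G + D' + K \<Longrightarrow> H \<sqsubseteq> G' + D + K \<Longrightarrow> H \<sqsubseteq> F + K"
    using dle_meet[of "G + D'" "G' + D"] by blast
  have "le (F, D + D') x" "le (F, D + D') y"
    using dle_add[OF F(1) dle_refl, of D] dle_add[OF F(2) dle_refl, of D']
    by (simp_all add: le_def xy ac_simps)
  moreover have "le (H, K) (F, D + D')" if "le (H, K) x" "le (H, K) y" for H K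
    using F(3)[of "H + (D + D')" K] that dle_cancel_iff[of "H + D" D' "G + K"]
      dle_cancel_iff[of "H + D'" D "G' + K"]
    by (simp add: le_def xy ac_simps)
  ultimately show ?thesis by (metis prod.exhaust)
qed

sublocale casari_frame pole le zero_point
proof
  fix x y u :: "'t multiset \<times> 't multiset"
  obtain G D G' D' G'' D'' where xyu: "x = (G, D)" "y = (G', D')" "u = (G'', D'')"
    by (metis prod.exhaust)
  show "le x x" by (simp add: le_def dle_refl)
  show "le x u" if "le x y" "le y u"
  proof -
    have "(G + D') + (G' + D'') \<sqsubseteq> (G' + D) + (G'' + D')"
      using dle_add[of "G + D'" "G' + D" "G' + D''" "G'' + D'"] that by (simp add: le_def xyu)
    then show ?thesis
      using dle_cancel_iff[of "G + D''" "G' + D'" "G'' + D"] by (simp add: le_def xyu ac_simps)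
  qed
  show "le (x + u) (y + u)" if "le x y"
    using that dle_cancel_iff[of "G + D'" "G'' + D''" "G' + D"] by (simp add: le_def xyu ac_simps)
  show "\<exists>y. le (x + y) 0 \<and> le 0 (x + y)"
    by (rule exI[of _ "(D, G)"]) (simp add: le_def xyu zero_prod_def ac_simps dle_refl)
  show "\<exists>m. le m x \<and> le m y \<and> (\<forall>u. le u x \<longrightarrow> le u y \<longrightarrow> le u m)"
    by (rule le_meet_ex)
  show le0: "le x 0" if "x \<in> pole"
    using that ded_dle by (auto simp: pole_def xyu le_zero_iff)
  show "x + y \<in> pole" if "x \<in> pole" "le y 0"
  proof (cases "D' = {#}")
    case True
    then show ?thesis using that weaken dle_add[of G D G' "{#}"] by (auto simp: pole_def xyu le_zero_iff)
  next
    case False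
    then have "size D' \<noteq> 0" by simp
    \<comment> \<open>An element of the pole has at least one negation, so a further one leads to
      the case where only degrees count.\<close>
    moreover have "1 \<le> size D" using that(1) by (auto simp: pole_def xyu)
    ultimately have "2 \<le> size (D + D')" by (simp only: size_union)
    moreover have "G + G' \<sqsubseteq> D + D'"
      using le0[OF that(1)] that(2) by (simp add: le_zero_iff xyu dle_add)
    ultimately show ?thesis by (simp add: pole_def xyu)
  qed
  show "x + zero_point \<in> pole \<longleftrightarrow> le x 0"
    using dle_cancel_iff[of G "{#undefined, undefined#}" D] by (auto simp: pole_def xyu le_zero_iff)
  show "le 0 zero_point" by (simp add: le_def zero_prod_def dle_refl)
qed

section \<open>Interpretation of terms as graded sets\<close>

definition interp :: "'t \<Rightarrow> ('t multiset \<times> 't multiset) set" where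
  "interp t = perp {({#}, {#t#})}"

lemma mem_interp: "(G, D) \<in> interp t \<longleftrightarrow> (G, add_mset t D) \<in> pole"
  by (simp add: interp_def perp_def)

lemma mem_perp_pos: "(G, D) \<in> perp {({#t#}, {#})} \<longleftrightarrow> (add_mset t G, D) \<in> pole"
  by (simp add: perp_def)

text \<open>Being below \<open>t\<close> and being in the closure of \<open>t\<close> agree by cut.
  When exactly one negation remains this is \<open>cut\<close> itself; otherwise at least two remain
  and \<open>t\<close> cancels in the comparison of degrees.\<close>

lemma interp_eq_closure: "interp t = perp (perp {({#t#}, {#})})"
proof
  have "({#}, {#t#}) \<in> perp {({#t#}, {#})}" by (simp add: mem_perp_pos ded_refl)
  then show "perp (perp {({#t#}, {#})}) \<subseteq> interp t"
    unfolding interp_def by (intro perp_antimono) simp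
  have "(G, D) + (G', D') \<in> pole"
    if GD: "(G, add_mset t D) \<in> pole" "(add_mset t G', D') \<in> pole" for G D G' D'
  proof (cases "D = {#} \<and> (\<exists>d. D' = {#d#})")
    case True
    then show ?thesis using GD cut[of G t G'] by auto
  next
    case False
    have "D' \<noteq> {#}" using GD(2) by auto
    then have "size D' \<noteq> 0" by simp
    moreover have "size D \<noteq> 0 \<or> size D' \<noteq> 1" using False size_1_singleton_mset[of D'] by auto
    ultimately have "2 \<le> size (D + D')" by (simp only: size_union) linarith
    moreover have "G \<sqsubseteq> add_mset t D" "add_mset t G' \<sqsubseteq> D'"
      using GD pole_le le_zero_iff by blast+
    then have "G + G' \<sqsubseteq> D + D'"
      using dle_add[of G "add_mset t D" "add_mset t G'" D'] dle_cancel[of "G + G'" "{#t#}" "D + D'"]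
      by (simp add: ac_simps)
    ultimately show ?thesis by (simp add: pole_def)
  qed
  then show "interp t \<subseteq> perp (perp {({#t#}, {#})})"
    by (auto simp: perp_def[of "perp {({#t#}, {#})}"] mem_interp mem_perp_pos)
qed

lemma perp_interp: "perp (interp t) = perp {({#t#}, {#})}"
  by (simp add: interp_eq_closure)

lemma graded_interp: "graded (interp t)"
proof -
  have "le x ({#t#}, {#})" if "x \<in> interp t" for x
    using that pole_le le_zero_iff by (cases x) (auto simp: mem_interp le_def)
  moreover have "({#t#}, {#}) \<in> interp t" by (simp add: mem_interp ded_refl)
  ultimately show ?thesis unfolding graded_def by (intro conjI bexI ballI) (simp_all add: interp_def)
qed

lemma interp_ded: "interp s = interp t \<Longrightarrow> {#s#} \<turnstile> t"
  using mem_interp ded_refl by (metis pole_singleton)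

text \<open>Membership is tested on the negative side: with \<open>D\<close> empty there is one
  negation and derivability decides, with \<open>D\<close> nonempty only degrees do.\<close>

lemma interp_residual:
  assumes "\<And>G. G \<turnstile> u \<longleftrightarrow> add_mset s G \<turnstile> t"
    and "\<And>G D. G \<sqsubseteq> add_mset u D \<longleftrightarrow> add_mset s G \<sqsubseteq> add_mset t D"
  shows "interp u = residual (interp s) (interp t)"
proof -
  have res: "residual (interp s) (interp t) = perp {({#s#}, {#t#})}"
    unfolding interp_eq_closure[of s] interp_def[of t] residual_closure
    by (simp add: setadd_def)
  have "(G, D) \<in> interp u \<longleftrightarrow> (G, D) \<in> perp {({#s#}, {#t#})}" for G D
    using assms by (cases "D = {#}") (simp_all add: mem_interp perp_def pole_add_mset)
  then show ?thesis unfolding res by auto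
qed

text \<open>Products, like the unit and joins below, are tested on the positive side, through
  \<open>perp {({#u#}, {#})}\<close>.\<close>

lemma interp_times:
  assumes "\<And>G d. add_mset u G \<turnstile> d \<longleftrightarrow> add_mset s (add_mset t G) \<turnstile> d"
    and "\<And>G D. add_mset u G \<sqsubseteq> D \<longleftrightarrow> add_mset s (add_mset t G) \<sqsubseteq> D"
  shows "interp u = perp (perp (setadd (interp s) (interp t)))"
proof -
  have "perp (setadd (interp s) (interp t)) = perp {({#s, t#}, {#})}"
    unfolding interp_eq_closure perp_setadd_closure perp_setadd_closure2
    by (simp add: setadd_def add_mset_commute)
  moreover have "(add_mset u G, D) \<in> pole \<longleftrightarrow> (add_mset s (add_mset t G), D) \<in> pole" for G D
    using assms by (simp add: pole_def)
  then have "perp {({#u#}, {#})} = perp {({#s, t#}, {#})}"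
    by (auto simp: perp_def)
  ultimately show ?thesis by (simp add: interp_eq_closure)
qed

lemma interp_neut:
  assumes "\<And>G d. add_mset u G \<turnstile> d \<longleftrightarrow> G \<turnstile> d"
    and "\<And>G D. add_mset u G \<sqsubseteq> D \<longleftrightarrow> G \<sqsubseteq> D"
  shows "interp u = {w. le w 0}"
proof -
  have "(add_mset u G, D) \<in> pole \<longleftrightarrow> (G, D) \<in> pole" for G D
    using assms by (simp add: pole_def)
  then have "perp {({#u#}, {#})} = perp {0}" by (auto simp: perp_def)
  then show ?thesis by (simp add: interp_eq_closure perp_zero perp_pole)
qed

lemma interp_meet:
  assumes "\<And>G. G \<turnstile> u \<longleftrightarrow> G \<turnstile> s \<and> G \<turnstile> t"
    and "\<And>G D. G \<sqsubseteq> add_mset u D \<longleftrightarrow> G \<sqsubseteq> add_mset s D \<and> G \<sqsubseteq> add_mset t D"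
  shows "interp u = interp s \<inter> interp t"
proof -
  have "(G, D) \<in> interp u \<longleftrightarrow> (G, D) \<in> interp s \<inter> interp t" for G D
    using assms by (cases "D = {#}") (simp_all add: mem_interp pole_add_mset)
  then show ?thesis by auto
qed

lemma interp_join:
  assumes "\<And>G d. add_mset u G \<turnstile> d \<longleftrightarrow> add_mset s G \<turnstile> d \<and> add_mset t G \<turnstile> d"
    and "\<And>G D. add_mset u G \<sqsubseteq> D \<longleftrightarrow> add_mset s G \<sqsubseteq> D \<and> add_mset t G \<sqsubseteq> D"
  shows "interp u = perp (perp (interp s) \<inter> perp (interp t))"
proof -
  have "(add_mset u G, D) \<in> pole \<longleftrightarrow> (add_mset s G, D) \<in> pole \<and> (add_mset t G, D) \<in> pole" for G D
    using assms by (auto simp: pole_def)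
  then have "perp (interp u) = perp (interp s) \<inter> perp (interp t)"
    by (auto simp: perp_interp mem_perp_pos)
  then show ?thesis by (metis interp_def perp_perp_perp)
qed

end

section \<open>BCI-algebras and sircomonoids\<close>

context bci_algebra
begin

lemma prefixing: "\<lbrakk>x \<in> carrier A; y \<in> carrier A; u \<in> carrier A\<rbrakk> \<Longrightarrow> (x \<setminus> y) \<setminus> ((y \<setminus> u) \<setminus> (x \<setminus> u)) = \<epsilon>"
  using ldiv_trans[of x y u] by (simp add: ldiv_eq_rdiv ldiv_closed rdiv_closed)

text \<open>The transitivity axiom at the unit. Here and below
  \<open>x \<setminus> y = \<epsilon>\<close> plays the role of \<open>x \<le> y\<close>, and
  \<open>neut_ldiv\<close> says that only \<epsilon> is above \<epsilon>.\<close>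

lemma ldiv_self [simp]: "x \<in> carrier A \<Longrightarrow> x \<setminus> x = \<epsilon>"
  using prefixing[of \<epsilon> \<epsilon> x] by (simp add: neut_closed neut_ldiv ldiv_closed)

lemma ldiv_neut_trans: "\<lbrakk>x \<in> carrier A; y \<in> carrier A; u \<in> carrier A; x \<setminus> y = \<epsilon>; y \<setminus> u = \<epsilon>\<rbrakk> \<Longrightarrow> x \<setminus> u = \<epsilon>"
  using prefixing[of x y u] by (simp add: neut_closed neut_ldiv ldiv_closed)

lemma ldiv_antimono: "\<lbrakk>x \<in> carrier A; y \<in> carrier A; u \<in> carrier A; x \<setminus> y = \<epsilon>\<rbrakk> \<Longrightarrow> (y \<setminus> u) \<setminus> (x \<setminus> u) = \<epsilon>"
  using prefixing[of x y u] by (simp add: neut_closed neut_ldiv ldiv_closed)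

lemma double_ldiv: "\<lbrakk>y \<in> carrier A; u \<in> carrier A\<rbrakk> \<Longrightarrow> y \<setminus> ((y \<setminus> u) \<setminus> u) = \<epsilon>"
  using prefixing[of \<epsilon> y u] by (simp add: neut_closed neut_ldiv ldiv_closed)

text \<open>Prefixing gives \<open>(y \<setminus> u) \<setminus> u\<close> in place of
  \<open>y\<close>, and \<open>y\<close> lies below that element.\<close>

lemma exchange_le:
  assumes "x \<in> carrier A" "y \<in> carrier A" "u \<in> carrier A"
  shows "(x \<setminus> (y \<setminus> u)) \<setminus> (y \<setminus> (x \<setminus> u)) = \<epsilon>"
proof -
  have "(((y \<setminus> u) \<setminus> u) \<setminus> (x \<setminus> u)) \<setminus> (y \<setminus> (x \<setminus> u)) = \<epsilon>"
    using assms by (intro ldiv_antimono double_ldiv ldiv_closed)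
  moreover have "(x \<setminus> (y \<setminus> u)) \<setminus> (((y \<setminus> u) \<setminus> u) \<setminus> (x \<setminus> u)) = \<epsilon>"
    using assms by (intro prefixing ldiv_closed)
  ultimately show ?thesis
    using assms ldiv_neut_trans[of "x \<setminus> (y \<setminus> u)" "((y \<setminus> u) \<setminus> u) \<setminus> (x \<setminus> u)" "y \<setminus> (x \<setminus> u)"]
    by (simp add: ldiv_closed)
qed

lemma exchange:
  assumes "x \<in> carrier A" "y \<in> carrier A" "u \<in> carrier A"
  shows "x \<setminus> (y \<setminus> u) = y \<setminus> (x \<setminus> u)"
  using assms by (simp add: antisym[OF _ _ exchange_le exchange_le] ldiv_closed)

lemma ldiv_mono: "\<lbrakk>x \<in> carrier A; y \<in> carrier A; u \<in> carrier A; y \<setminus> u = \<epsilon>\<rbrakk> \<Longrightarrow> (x \<setminus> y) \<setminus> (x \<setminus> u) = \<epsilon>"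
  using prefixing[of x y u] exchange[of "x \<setminus> y" "y \<setminus> u" "x \<setminus> u"]
  by (simp add: neut_closed neut_ldiv ldiv_closed)

section \<open>Inverses and the abelian group of regular elements\<close>

abbreviation inv_elt :: "'a \<Rightarrow> 'a" where "inv_elt x \<equiv> x \<setminus> \<epsilon>"

text \<open>Exchange equates \<open>x \<setminus> (y \<setminus> y)\<close> with
  \<open>y \<setminus> (x \<setminus> y)\<close>, and both inner divisions are \<epsilon>. Inversion
  thus collapses the order.\<close>

lemma inv_elt_eq_of_le:
  assumes "x \<in> carrier A" "y \<in> carrier A" "x \<setminus> y = \<epsilon>"
  shows "inv_elt x = inv_elt y"
proof -
  have "x \<setminus> (y \<setminus> y) = y \<setminus> (x \<setminus> y)" using assms by (intro exchange)
  then show ?thesis using assms by simp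
qed

lemma double_inv_elt: "x \<in> carrier A \<Longrightarrow> inv_elt (inv_elt (inv_elt x)) = inv_elt x"
  using inv_elt_eq_of_le[OF _ _ double_ldiv[of x \<epsilon>]] by (simp add: neut_closed ldiv_closed)

text \<open>For regular \<open>x\<close>, exchange shows that \<open>u \<setminus> x\<close> depends
  only on the inverse of \<open>u\<close>, which double inversion of \<open>u\<close>
  preserves.\<close>

lemma regular_ldiv:
  assumes "a \<in> carrier A" "x \<in> carrier A" "inv_elt (inv_elt x) = x"
  shows "inv_elt (inv_elt (a \<setminus> x)) = a \<setminus> x"
proof (rule antisym)
  let ?y = "inv_elt x" let ?w = "a \<setminus> x"
  have y: "?y \<in> carrier A" "?w \<in> carrier A" "inv_elt ?w \<in> carrier A" "inv_elt (inv_elt ?w) \<in> carrier A"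
    using assms neut_closed ldiv_closed by auto
  show "?w \<setminus> inv_elt (inv_elt ?w) = \<epsilon>" using y double_ldiv neut_closed by blast
  have swap: "u \<setminus> x = ?y \<setminus> inv_elt u" if "u \<in> carrier A" for u
    using exchange[of u ?y \<epsilon>] that y neut_closed assms(3) by simp
  have "inv_elt (inv_elt ?w) \<setminus> ?w = a \<setminus> (inv_elt (inv_elt ?w) \<setminus> x)"
    using y assms by (intro exchange)
  also have "\<dots> = a \<setminus> (?w \<setminus> x)"
    by (simp only: swap y double_inv_elt)
  also have "\<dots> = ?w \<setminus> ?w" using y assms by (intro exchange)
  also have "\<dots> = \<epsilon>" using y by simp
  finally show "inv_elt (inv_elt ?w) \<setminus> ?w = \<epsilon>" .
qed (use assms neut_closed ldiv_closed in auto)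

text \<open>In the chain from \<open>inv_elt u\<close> to \<open>y \<setminus> z\<close> to
  \<open>inv_elt z \<setminus> inv_elt y\<close>, with \<open>u = x \<setminus> y\<close> and
  \<open>z = u \<setminus> y\<close>, each element lies below the next. Inversion makes them equal,
  and \<open>x\<close> below \<open>z\<close> gives \<open>inv_elt x = inv_elt z\<close>.\<close>

lemma inv_elt_ldiv:
  assumes "x \<in> carrier A" "y \<in> carrier A"
  shows "inv_elt (x \<setminus> y) = inv_elt x \<setminus> inv_elt y"
proof -
  let ?n = inv_elt
  let ?u = "x \<setminus> y" let ?z = "?u \<setminus> y"
  note closed = assms neut_closed ldiv_closed
  have nz: "?n x = ?n ?z" using assms by (intro inv_elt_eq_of_le double_ldiv ldiv_closed)
  have "?n ?u \<setminus> ((\<epsilon> \<setminus> y) \<setminus> ?z) = \<epsilon>" using closed by (intro prefixing) auto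
  then have "?n (?n ?u) = ?n (y \<setminus> ?z)"
    using closed by (intro inv_elt_eq_of_le) (auto simp: neut_ldiv)
  moreover have "?n (y \<setminus> ?z) = ?n (?n ?z \<setminus> ?n y)"
    using closed by (intro inv_elt_eq_of_le prefixing) auto
  ultimately have "?n (?n (?n ?u)) = ?n (?n (?n x \<setminus> ?n y))" by (simp add: nz)
  then show ?thesis
    using closed by (simp add: double_inv_elt regular_ldiv)
qed

text \<open>The group law -x + x = 0 acting on a regular element; writing \<open>y\<close> as an
  inverse lets exchange bring the two copies of \<open>inv_elt x\<close> together.\<close>

lemma inv_elt_cancel:
  assumes "x \<in> carrier A" "y \<in> carrier A" "inv_elt (inv_elt y) = y"
  shows "inv_elt x \<setminus> (x \<setminus> y) = y"
proof -
  let ?d = "inv_elt y"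
  note closed = assms(1,2) neut_closed ldiv_closed
  have "x \<setminus> y = ?d \<setminus> inv_elt x"
    using exchange[of x ?d \<epsilon>] closed assms(3) by simp
  then have "inv_elt x \<setminus> (x \<setminus> y) = ?d \<setminus> (inv_elt x \<setminus> inv_elt x)"
    using closed exchange[of "inv_elt x" ?d "inv_elt x"] by simp
  also have "\<dots> = y" using closed assms(3) by simp
  finally show ?thesis .
qed

text \<open>Reading \<open>x \<setminus> y\<close> as y - x, this is c - (y - x) = (c - y) +
  x.\<close>

lemma inv_ldiv_ldiv:
  assumes "x \<in> carrier A" "y \<in> carrier A" "c \<in> carrier A" "inv_elt (inv_elt c) = c"
  shows "(x \<setminus> y) \<setminus> c = inv_elt x \<setminus> (y \<setminus> c)"
proof -
  note closed = assms(1-3) neut_closed ldiv_closed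
  have swap: "u \<setminus> c = inv_elt c \<setminus> inv_elt u" if "u \<in> carrier A" for u
    using exchange[of u "inv_elt c" \<epsilon>] that closed assms(4) by simp
  have "(x \<setminus> y) \<setminus> c = inv_elt c \<setminus> (inv_elt x \<setminus> inv_elt y)"
    using closed by (simp add: swap inv_elt_ldiv)
  also have "\<dots> = inv_elt x \<setminus> (inv_elt c \<setminus> inv_elt y)"
    using closed by (intro exchange) auto
  finally show ?thesis using closed by (simp add: swap)
qed

text \<open>The guards make the iterated steps commute also outside of the carrier, as \<open>fold_mset\<close>
  requires.\<close>

definition imps :: "('i \<Rightarrow> 'a) \<Rightarrow> 'i multiset \<Rightarrow> 'a \<Rightarrow> 'a" where
  "imps f G c = fold_mset (\<lambda>i c. if f i \<in> carrier A \<and> c \<in> carrier A then f i \<setminus> c else c) c G"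

lemma imps_commute:
  "comp_fun_commute (\<lambda>i c. if f i \<in> carrier A \<and> c \<in> carrier A then f i \<setminus> c else c)"
proof
  show "(\<lambda>c. if f j \<in> carrier A \<and> c \<in> carrier A then f j \<setminus> c else c)
      \<circ> (\<lambda>c. if f i \<in> carrier A \<and> c \<in> carrier A then f i \<setminus> c else c)
    = (\<lambda>c. if f i \<in> carrier A \<and> c \<in> carrier A then f i \<setminus> c else c)
      \<circ> (\<lambda>c. if f j \<in> carrier A \<and> c \<in> carrier A then f j \<setminus> c else c)" for i j
    by (auto simp: fun_eq_iff ldiv_closed exchange[of "f j" "f i"])
qed

lemma imps_empty [simp]: "imps f {#} c = c"
  by (simp add: imps_def)

lemma imps_closed: "c \<in> carrier A \<Longrightarrow> imps f G c \<in> carrier A"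
  unfolding imps_def
  by (induction G) (simp_all add: comp_fun_commute.fold_mset_add_mset[OF imps_commute] ldiv_closed)

lemma imps_union: "imps f (G + D) c = imps f G (imps f D c)"
  unfolding imps_def
  by (subst add.commute) (rule comp_fun_commute.fold_mset_union[OF imps_commute])

lemma imps_left_commute: "imps f G (imps f D c) = imps f D (imps f G c)"
  by (metis imps_union add.commute)

lemma imps_add_mset:
  "\<lbrakk>f i \<in> carrier A; c \<in> carrier A\<rbrakk> \<Longrightarrow> imps f (add_mset i G) c = f i \<setminus> imps f G c"
  using imps_closed[of c f G] unfolding imps_def
  by (simp add: comp_fun_commute.fold_mset_add_mset[OF imps_commute])

lemma imps_ldiv:
  assumes "range f \<subseteq> carrier A" "x \<in> carrier A" "c \<in> carrier A"
  shows "imps f G (x \<setminus> c) = x \<setminus> imps f G c"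
proof (induction G)
  case (add i G)
  have "f i \<in> carrier A" using assms by auto
  then show ?case using add assms exchange[of x "f i" "imps f G c"]
    by (simp add: imps_add_mset imps_closed ldiv_closed)
qed simp

lemma imps_add_mset_inner:
  "\<lbrakk>range f \<subseteq> carrier A; c \<in> carrier A\<rbrakk> \<Longrightarrow> imps f (add_mset i G) c = imps f G (f i \<setminus> c)"
  by (simp add: imps_add_mset imps_ldiv range_subsetD)

lemma imps_mono:
  assumes "range f \<subseteq> carrier A" "x \<in> carrier A" "y \<in> carrier A" "x \<setminus> y = \<epsilon>"
  shows "imps f G x \<setminus> imps f G y = \<epsilon>"
proof (induction G)
  case (add i G)
  have "f i \<in> carrier A" using assms by auto
  then show ?case using add assms by (simp add: imps_add_mset imps_closed ldiv_mono)
qed (simp add: assms)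

lemma regular_imps:
  assumes "range f \<subseteq> carrier A" "c \<in> carrier A" "inv_elt (inv_elt c) = c"
  shows "inv_elt (inv_elt (imps f G c)) = imps f G c"
proof (induction G)
  case (add i G)
  have "f i \<in> carrier A" using assms by auto
  then show ?case using add assms by (simp add: imps_add_mset imps_closed regular_ldiv)
qed (simp add: assms)

text \<open>By \<open>inv_elt_cancel\<close>, every single division is invertible on regular
  elements.\<close>

lemma imps_cancel:
  assumes "range f \<subseteq> carrier A" "x \<in> carrier A" "inv_elt (inv_elt x) = x"
    "y \<in> carrier A" "inv_elt (inv_elt y) = y" "imps f G x = imps f G y"
  shows "x = y"
  using assms(6)
proof (induction G)
  case (add i G)
  have i: "f i \<in> carrier A" using assms by auto
  then have "inv_elt (f i) \<setminus> imps f (add_mset i G) u = imps f G u"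
    if "u \<in> carrier A" "inv_elt (inv_elt u) = u" for u
    using that assms(1) inv_elt_cancel by (simp add: imps_add_mset imps_closed regular_imps)
  then show ?case using add assms by metis
qed simp

end

text \<open>The multisets \<open>pos t\<close> and \<open>neg t\<close> collect the variables of \<open>t\<close> by the sign with which they
  occur in the value of \<open>t\<close> in a free abelian group.\<close>

locale bci_valuation = bci_algebra A for A :: "('a, 'm) div_alg_scheme" (structure) +
  fixes val :: "nat \<Rightarrow> 'a" and eval :: "'t \<Rightarrow> 'a" and pos neg :: "'t \<Rightarrow> nat multiset"
  assumes val_closed: "range val \<subseteq> carrier A"
    and eval_closed: "range eval \<subseteq> carrier A"
    and signed_vars: "\<lbrakk>c \<in> carrier A; inv_elt (inv_elt c) = c\<rbrakk>
          \<Longrightarrow> imps val (neg t) (eval t \<setminus> c) = imps val (pos t) c"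
begin

section \<open>Sequents ordered by degree in a free abelian group\<close>

definition Pos :: "'t multiset \<Rightarrow> nat multiset" where "Pos G = \<Sum>\<^sub># (image_mset pos G)"
definition Neg :: "'t multiset \<Rightarrow> nat multiset" where "Neg G = \<Sum>\<^sub># (image_mset neg G)"

lemma Pos_simps [simp]: "Pos {#} = {#}" "Pos (add_mset t G) = pos t + Pos G" "Pos (G + D) = Pos G + Pos D"
  by (simp_all add: Pos_def)

lemma Neg_simps [simp]: "Neg {#} = {#}" "Neg (add_mset t G) = neg t + Neg G" "Neg (G + D) = Neg G + Neg D"
  by (simp_all add: Neg_def)

text \<open>The multiset order on variables is total and compatible with addition, so it totally
  orders the differences \<open>Pos - Neg\<close>, which represent elements of the free abelian
  group.\<close>

definition dle :: "'t multiset \<Rightarrow> 't multiset \<Rightarrow> bool" where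
  "dle G D \<longleftrightarrow> Pos G + Neg D \<le> Neg G + Pos D"

definition ded :: "'t multiset \<Rightarrow> 't \<Rightarrow> bool" where
  "ded G t \<longleftrightarrow> Pos G + neg t < Neg G + pos t \<or>
     Pos G + neg t = Neg G + pos t \<and> imps eval G (eval t) = \<epsilon>"

lemma eval_mem: "eval t \<in> carrier A"
  using eval_closed by auto

lemma neut_regular: "inv_elt (inv_elt \<epsilon>) = \<epsilon>"
  by (simp add: neut_closed)

text \<open>Iterated divisions of a regular element stay regular, so \<open>signed_vars\<close>
  applies at every step of the induction.\<close>

lemma signed_vars_mset:
  assumes "c \<in> carrier A" "inv_elt (inv_elt c) = c"
  shows "imps val (Neg G) (imps eval G c) = imps val (Pos G) c"
proof (induction G)
  case (add t G)
  have "imps val (neg t + Neg G) (imps eval (add_mset t G) c)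
     = imps val (Neg G) (imps val (neg t) (eval t \<setminus> imps eval G c))"
    using assms by (simp add: imps_add_mset eval_mem add.commute[of "neg t"] imps_union)
  also have "\<dots> = imps val (pos t) (imps val (Neg G) (imps eval G c))"
    using assms eval_closed
    by (simp add: signed_vars imps_closed regular_imps imps_left_commute[of _ "pos t"])
  finally show ?case using add by (simp add: imps_union)
qed simp

text \<open>The Glivenko property. If the degree is 0, \<open>signed_vars_mset\<close> equates both
  sides after division by the same variables, and \<open>imps_cancel\<close> removes these.\<close>

lemma imps_neut:
  assumes "Pos G = Neg G" shows "imps eval G \<epsilon> = \<epsilon>"
proof -
  have "imps val (Pos G) (imps eval G \<epsilon>) = imps val (Pos G) \<epsilon>"
    using signed_vars_mset[OF neut_closed neut_regular, of G] assms by simp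
  then show ?thesis
    by (rule imps_cancel[OF val_closed imps_closed[OF neut_closed]
          regular_imps[OF eval_closed neut_closed neut_regular] neut_closed neut_regular])
qed

sublocale sequent_frame ded dle
proof
  fix G D H G' D' :: "'t multiset" and s t :: 't
  show "dle G G" by (simp add: dle_def add.commute)
  show "dle (G + G') (D + D')" if "dle G D" "dle G' D'"
    using add_mono[of "Pos G + Neg D" "Neg G + Pos D" "Pos G' + Neg D'" "Neg G' + Pos D'"] that
    by (simp add: dle_def ac_simps)
  show cancel: "dle G D" if "dle (G + H) (D + H)"
    using that add_le_cancel_right[of "Pos G + Neg D" "Pos H + Neg H" "Neg G + Pos D"]
    by (simp add: dle_def ac_simps)
  show "ded (G + H) t" if GH: "ded G t" "dle H {#}"
  proof -
    have le: "Pos H \<le> Neg H" using GH by (simp add: dle_def)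
    consider "Pos G + neg t < Neg G + pos t" | "Pos H < Neg H" "Pos G + neg t \<le> Neg G + pos t"
      | "Pos H = Neg H" "Pos G + neg t = Neg G + pos t" "imps eval G (eval t) = \<epsilon>"
      using GH(1) le unfolding ded_def by (auto simp only: order.order_iff_strict)
    then show ?thesis
    proof cases
      case 1
      then show ?thesis using add_less_le_mono[OF 1 le] by (simp add: ded_def ac_simps)
    next
      case 2
      then show ?thesis using add_le_less_mono[OF 2(2,1)] by (simp add: ded_def ac_simps)
    next
      case 3
      \<comment> \<open>The divisions by \<open>G\<close> already give \<epsilon>; what is left is
        the Glivenko property for \<open>H\<close>.\<close>
      have "imps eval (G + H) (eval t) = imps eval H \<epsilon>"
        by (simp add: add.commute[of G] imps_union 3)
      then show ?thesis using 3 by (simp add: ded_def imps_neut ac_simps)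
    qed
  qed
  show "dle G {#t#}" if "ded G t"
    using that by (auto simp: dle_def ded_def)
  show "ded {#t#} t"
    by (simp add: ded_def imps_add_mset eval_mem add.commute)
  show "ded (G + D) t" if GD: "ded G s" "ded (D + {#s#}) t"
  proof -
    have le: "Pos G + neg s \<le> Neg G + pos s" "pos s + Pos D + neg t \<le> neg s + Neg D + pos t"
      using GD by (auto simp: ded_def)
    \<comment> \<open>One strict comparison makes the sum strict, so the algebra matters only when
      both degrees agree. The variables of \<open>s\<close> occur on both sides of the sum and
      cancel.\<close>
    consider "Pos G + neg s < Neg G + pos s" | "pos s + Pos D + neg t < neg s + Neg D + pos t"
      | "Pos G + neg s = Neg G + pos s" "pos s + Pos D + neg t = neg s + Neg D + pos t"
        "imps eval G (eval s) = \<epsilon>" "eval s \<setminus> imps eval D (eval t) = \<epsilon>"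
      using GD by (auto simp: ded_def imps_add_mset eval_mem)
    then show ?thesis
    proof cases
      case 1
      have "(Pos G + Pos D + neg t) + (pos s + neg s) < (Neg G + Neg D + pos t) + (pos s + neg s)"
        using add_less_le_mono[OF 1 le(2)] by (simp add: ac_simps)
      then show ?thesis unfolding ded_def by (simp only: add_less_cancel_right Pos_simps Neg_simps simp_thms)
    next
      case 2
      have "(Pos G + Pos D + neg t) + (pos s + neg s) < (Neg G + Neg D + pos t) + (pos s + neg s)"
        using add_le_less_mono[OF le(1) 2] by (simp add: ac_simps)
      then show ?thesis unfolding ded_def by (simp only: add_less_cancel_right Pos_simps Neg_simps simp_thms)
    next
      case 3
      have "(Pos G + neg s) + (pos s + Pos D + neg t) = (Neg G + pos s) + (neg s + Neg D + pos t)"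
        using 3 by simp
      then have "(Pos G + Pos D + neg t) + (pos s + neg s) = (Neg G + Neg D + pos t) + (pos s + neg s)"
        by (simp only: ac_simps)
      then have deg: "Pos G + Pos D + neg t = Neg G + Neg D + pos t" by (simp only: add_right_cancel)
      \<comment> \<open>By monotonicity \<epsilon> lies below the division of \<open>eval t\<close>
        by \<open>G + D\<close>, and only \<epsilon> itself does so.\<close>
      have "imps eval G (eval s) \<setminus> imps eval G (imps eval D (eval t)) = \<epsilon>"
        using 3 by (intro imps_mono eval_closed eval_mem imps_closed)
      then have "imps eval (G + D) (eval t) = \<epsilon>"
        by (simp add: imps_union 3 neut_ldiv imps_closed eval_mem)
      then show ?thesis using deg unfolding ded_def by simp
    qed
  qed
  show "\<exists>F. dle F G \<and> dle F D \<and> (\<forall>H K. dle H (G + K) \<longrightarrow> dle H (D + K) \<longrightarrow> dle H (F + K))"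
  \<comment> \<open>In a total order the smaller of the two is the meet.\<close>
  proof (cases "dle G D")
    case True
    then show ?thesis by (intro exI[of _ G]) (auto simp: dle_def add.commute)
  next
    case False
    then have "dle D G" by (auto simp: dle_def add.commute)
    then show ?thesis by (intro exI[of _ D]) (auto simp: dle_def add.commute)
  qed
qed

text \<open>The two strict comparisons of degrees exclude each other and each excludes equality, so
  both derivations come from the algebra, where antisymmetry applies.\<close>

lemma interp_eq_imp:
  assumes "interp s = interp t" shows "eval s = eval t"
proof -
  have "ded {#s#} t" "ded {#t#} s" using assms interp_ded by metis+
  then have "eval s \<setminus> eval t = \<epsilon>" "eval t \<setminus> eval s = \<epsilon>"
    by (auto simp: ded_def imps_add_mset eval_mem add.commute)
  then show ?thesis using antisym eval_mem by metis
qed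

lemma interp_ldiv:
  assumes "eval u = eval s \<setminus> eval t" "pos u = neg s + pos t" "neg u = pos s + neg t"
  shows "interp u = residual (interp s) (interp t)"
  using assms by (intro interp_residual)
    (simp_all add: ded_def dle_def imps_add_mset_inner[OF eval_closed] eval_mem ac_simps)

lemma interp_neutral:
  assumes "eval u = \<epsilon>" "pos u = {#}" "neg u = {#}"
  shows "interp u = {w. le w 0}"
  using assms by (intro interp_neut)
    (simp_all add: ded_def dle_def imps_add_mset eval_mem neut_closed neut_ldiv imps_closed)

text \<open>The product is described by its divisions only, since the signature of the locale has
  none.\<close>

lemma interp_product:
  assumes "\<And>c. c \<in> carrier A \<Longrightarrow> eval u \<setminus> c = eval s \<setminus> (eval t \<setminus> c)"
    "pos u = pos s + pos t" "neg u = neg s + neg t"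
  shows "interp u = perp (perp (setadd (interp s) (interp t)))"
  using assms by (intro interp_times)
    (simp_all add: ded_def dle_def imps_add_mset eval_mem imps_closed ac_simps)

end

section \<open>Signed variables of terms and the counterexamples they give\<close>

context bci_algebra
begin

text \<open>After \<open>inv_ldiv_ldiv\<close>, the hypothesis on \<open>x\<close> is used from
  right to left for the regular element \<open>inv_elt x \<setminus> ?X\<close>, where
  \<open>x\<close> and its inverse then cancel.\<close>

lemma signed_ldiv:
  assumes f: "range f \<subseteq> carrier A" and c: "x \<in> carrier A" "y \<in> carrier A" "c \<in> carrier A"
    and regular: "inv_elt (inv_elt c) = c"
    and x: "\<And>c. \<lbrakk>c \<in> carrier A; inv_elt (inv_elt c) = c\<rbrakk> \<Longrightarrow> imps f nx (x \<setminus> c) = imps f px c"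
    and y: "\<And>c. \<lbrakk>c \<in> carrier A; inv_elt (inv_elt c) = c\<rbrakk> \<Longrightarrow> imps f ny (y \<setminus> c) = imps f py c"
  shows "imps f (px + ny) ((x \<setminus> y) \<setminus> c) = imps f (nx + py) c"
proof -
  let ?X = "imps f py c"
  have X: "?X \<in> carrier A" "inv_elt (inv_elt ?X) = ?X"
    using f c regular by (simp_all add: imps_closed regular_imps)
  have i: "inv_elt x \<in> carrier A" using c by (simp add: ldiv_closed neut_closed)
  have "imps f (px + ny) ((x \<setminus> y) \<setminus> c) = imps f px (inv_elt x \<setminus> imps f ny (y \<setminus> c))"
    using f c regular i by (simp add: imps_union inv_ldiv_ldiv imps_ldiv ldiv_closed)
  also have "\<dots> = imps f px (inv_elt x \<setminus> ?X)" using c regular y by simp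
  also have "\<dots> = imps f nx (x \<setminus> (inv_elt x \<setminus> ?X))"
    using X i x[of "inv_elt x \<setminus> ?X"] by (simp add: ldiv_closed regular_ldiv)
  also have "\<dots> = imps f nx ?X"
    using X i c exchange[of x "inv_elt x" ?X] by (simp add: inv_elt_cancel)
  finally show ?thesis by (simp add: imps_union)
qed

end

text \<open>The Boolean selects positive or negative occurrences. Their difference is the value of
  the term when \<open>x \<setminus> y\<close> is read as y - x.\<close>

primrec div_signs :: "div_term \<Rightarrow> bool \<Rightarrow> nat multiset" where
  "div_signs (DVar i) b = (if b then {#i#} else {#})"
| "div_signs DNeut b = {#}"
| "div_signs (DLdiv s t) b = div_signs s (\<not> b) + div_signs t b"
| "div_signs (DRdiv s t) b = div_signs t (\<not> b) + div_signs s b"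

primrec mult_div_signs :: "mult_div_term \<Rightarrow> bool \<Rightarrow> nat multiset" where
  "mult_div_signs (MVar i) b = (if b then {#i#} else {#})"
| "mult_div_signs MNeut b = {#}"
| "mult_div_signs (MLdiv s t) b = mult_div_signs s (\<not> b) + mult_div_signs t b"
| "mult_div_signs (MRdiv s t) b = mult_div_signs t (\<not> b) + mult_div_signs s b"
| "mult_div_signs (MTimes s t) b = mult_div_signs s b + mult_div_signs t b"

lemma (in bci_algebra) div_eval_closed: "range v \<subseteq> carrier A \<Longrightarrow> div_eval A v t \<in> carrier A"
  by (induction t) (auto simp: neut_closed ldiv_closed rdiv_closed)

lemma (in sircomonoid) mult_div_eval_closed: "range v \<subseteq> carrier A \<Longrightarrow> mult_div_eval A v t \<in> carrier A"
  by (induction t) (auto simp: neut_closed ldiv_closed rdiv_closed times_closed)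

lemma (in sircomonoid) bci_reduct: "bci_algebra A"
  by unfold_locales (rule ldiv_eq_rdiv)

lemma (in bci_algebra) div_valuation:
  assumes v: "range v \<subseteq> carrier A"
  shows "bci_valuation A v (div_eval A v) (\<lambda>t. div_signs t True) (\<lambda>t. div_signs t False)"
proof unfold_locales
  show "imps v (div_signs t False) (div_eval A v t \<setminus> c) = imps v (div_signs t True) c"
    if "c \<in> carrier A" "inv_elt (inv_elt c) = c" for t c
    using that
  proof (induction t arbitrary: c)
    case (DVar i)
    then show ?case using imps_add_mset[of v i c "{#}"] range_subsetD[OF v] by simp
  next
    case (DLdiv s t)
    then show ?case using signed_ldiv[OF v] div_eval_closed[OF v] by simp
  next
    case (DRdiv s t)
    then show ?case using signed_ldiv[OF v] div_eval_closed[OF v] by (simp add: ldiv_eq_rdiv[symmetric])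
  qed (simp add: neut_ldiv)
qed (use v div_eval_closed in auto)

lemma (in sircomonoid) mult_div_valuation:
  assumes v: "range v \<subseteq> carrier A"
  shows "bci_valuation A v (mult_div_eval A v) (\<lambda>t. mult_div_signs t True) (\<lambda>t. mult_div_signs t False)"
proof -
  interpret bci_algebra A by (rule bci_reduct)
  show ?thesis
  proof unfold_locales
    show "imps v (mult_div_signs t False) (mult_div_eval A v t \<setminus> c) = imps v (mult_div_signs t True) c"
      if "c \<in> carrier A" "inv_elt (inv_elt c) = c" for t c
      using that
    proof (induction t arbitrary: c)
      case (MVar i)
      then show ?case using imps_add_mset[of v i c "{#}"] range_subsetD[OF v] by simp
    next
      case (MLdiv s t)
      then show ?case using signed_ldiv[OF v] mult_div_eval_closed[OF v] by simp
    next
      case (MRdiv s t)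
      then show ?case using signed_ldiv[OF v] mult_div_eval_closed[OF v] by (simp add: ldiv_eq_rdiv[symmetric])
    next
      case (MTimes s t)
      let ?s = "mult_div_eval A v s" let ?t = "mult_div_eval A v t"
      note closed = mult_div_eval_closed[OF v]
      have "imps v (mult_div_signs (MTimes s t) False) (mult_div_eval A v (MTimes s t) \<setminus> c)
        = imps v (mult_div_signs s False) (imps v (mult_div_signs t False) (?t \<setminus> (?s \<setminus> c)))"
        using MTimes closed by (simp add: imps_union times_ldiv)
      also have "\<dots> = imps v (mult_div_signs s False) (imps v (mult_div_signs t True) (?s \<setminus> c))"
        using MTimes closed by (simp add: ldiv_closed regular_ldiv)
      also have "\<dots> = imps v (mult_div_signs t True) (imps v (mult_div_signs s True) c)"
        using MTimes closed by (simp add: imps_left_commute[of _ "mult_div_signs s False"])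
      finally show ?case by (simp add: imps_union imps_left_commute[of _ "mult_div_signs t True"])
    qed (simp add: neut_ldiv)
  qed (use v mult_div_eval_closed in auto)
qed

text \<open>The frame is built from terms evaluated under a refuting \<open>v\<close>, so its type
  does not depend on \<open>B\<close>. Each term evaluates to its own interpretation, and equal
  interpretations would give equal values in \<open>B\<close>.\<close>

lemma div_frame_counterexample:
  assumes "bci_algebra B" "\<not> div_valid B s t"
  shows "\<exists>A :: (div_term multiset \<times> div_term multiset) set pointed_lattice_div_alg.
    casari_algebra A \<and> \<not> div_valid A s t"
proof -
  obtain v where v: "range v \<subseteq> carrier B" "div_eval B v s \<noteq> div_eval B v t"
    using assms(2) by (auto simp: div_valid_def)
  interpret bci_valuation B v "div_eval B v" "\<lambda>t. div_signs t True" "\<lambda>t. div_signs t False"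
    by (rule bci_algebra.div_valuation[OF assms(1) v(1)])
  have hom: "div_eval frame_alg (\<lambda>i. interp (DVar i)) t = interp t" for t
  proof (induction t)
    case DNeut
    then show ?case using interp_neutral[of DNeut] by (simp add: frame_alg_def)
  next
    case (DLdiv s t)
    then show ?case using interp_ldiv[of "DLdiv s t" s t] by (simp add: frame_alg_def)
  next
    case (DRdiv s t)
    then show ?case using interp_ldiv[of "DRdiv s t" t s]
      by (simp add: frame_alg_def ldiv_eq_rdiv eval_mem)
  qed simp
  have "range (\<lambda>i. interp (DVar i)) \<subseteq> carrier frame_alg"
    using graded_interp by (auto simp: frame_alg_def)
  then have "\<not> div_valid frame_alg s t"
    using v(2) interp_eq_imp unfolding div_valid_def by (metis hom)
  then show ?thesis using casari_frame_alg by blast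
qed

lemma mult_div_frame_counterexample:
  assumes "sircomonoid B" "\<not> mult_div_valid B s t"
  shows "\<exists>A :: (mult_div_term multiset \<times> mult_div_term multiset) set pointed_lattice_div_alg.
    casari_algebra A \<and> \<not> mult_div_valid A s t"
proof -
  obtain v where v: "range v \<subseteq> carrier B" "mult_div_eval B v s \<noteq> mult_div_eval B v t"
    using assms(2) by (auto simp: mult_div_valid_def)
  interpret sircomonoid B by (rule assms(1))
  interpret bci_valuation B v "mult_div_eval B v" "\<lambda>t. mult_div_signs t True" "\<lambda>t. mult_div_signs t False"
    by (rule mult_div_valuation[OF v(1)])
  have hom: "mult_div_eval frame_alg (\<lambda>i. interp (MVar i)) t = interp t" for t
  proof (induction t)
    case MNeut
    then show ?case using interp_neutral[of MNeut] by (simp add: frame_alg_def)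
  next
    case (MLdiv s t)
    then show ?case using interp_ldiv[of "MLdiv s t" s t] by (simp add: frame_alg_def)
  next
    case (MRdiv s t)
    then show ?case using interp_ldiv[of "MRdiv s t" t s]
      by (simp add: frame_alg_def ldiv_eq_rdiv eval_mem)
  next
    case (MTimes s t)
    \<comment> \<open>The factors are swapped because dividing by a product divides by its factors
      in reverse order.\<close>
    have "interp (MTimes s t) = perp (perp (setadd (interp t) (interp s)))"
      by (rule interp_product) (simp_all add: times_ldiv eval_mem add.commute)
    then show ?case using MTimes by (simp add: frame_alg_def setadd_commute[of "interp s"])
  qed simp
  have "range (\<lambda>i. interp (MVar i)) \<subseteq> carrier frame_alg"
    using graded_interp by (auto simp: frame_alg_def)
  then have "\<not> mult_div_valid frame_alg s t"
    using v(2) interp_eq_imp unfolding mult_div_valid_def by (metis hom)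
  then show ?thesis using casari_frame_alg by blast
qed

section \<open>Commutative integrally closed residuated lattices\<close>

context comm_integrally_closed_residuated_lattice
begin

abbreviation inv_elt :: "'a \<Rightarrow> 'a" where "inv_elt x \<equiv> x \<setminus> \<epsilon>"

lemma times_closed: "\<lbrakk>x \<in> carrier A; y \<in> carrier A\<rbrakk> \<Longrightarrow> x \<cdot> y \<in> carrier A"
  using monoid.m_closed[OF monoid] by simp

lemma neut_closed: "\<epsilon> \<in> carrier A"
  using monoid.one_closed[OF monoid] by simp

lemmas closed [simp] = times_closed neut_closed ldiv_closed rdiv_closed meet_closed join_closed

lemma neut_times: "x \<in> carrier A \<Longrightarrow> \<epsilon> \<cdot> x = x"
  using monoid.l_one[OF monoid] by simp

lemma times_neut: "x \<in> carrier A \<Longrightarrow> x \<cdot> \<epsilon> = x"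
  using monoid.r_one[OF monoid] by simp

lemma times_assoc: "\<lbrakk>x \<in> carrier A; y \<in> carrier A; z \<in> carrier A\<rbrakk> \<Longrightarrow> (x \<cdot> y) \<cdot> z = x \<cdot> (y \<cdot> z)"
  using monoid.m_assoc[OF monoid] by simp

lemma times_lcomm: "\<lbrakk>x \<in> carrier A; y \<in> carrier A; z \<in> carrier A\<rbrakk> \<Longrightarrow> x \<cdot> (y \<cdot> z) = y \<cdot> (x \<cdot> z)"
  using times_assoc[of x y z] times_assoc[of y x z] by (simp add: times_comm[of x y])

lemmas times_ac = times_assoc times_comm times_lcomm

lemma le_refl: "x \<in> carrier A \<Longrightarrow> x \<preceq> x"
  unfolding lat_le_def by (metis join_absorb meet_absorb meet_closed)

lemma le_trans: "\<lbrakk>x \<preceq> y; y \<preceq> z; x \<in> carrier A; y \<in> carrier A; z \<in> carrier A\<rbrakk> \<Longrightarrow> x \<preceq> z"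
  unfolding lat_le_def by (metis meet_assoc)

lemma le_antisym: "\<lbrakk>x \<preceq> y; y \<preceq> x; x \<in> carrier A; y \<in> carrier A\<rbrakk> \<Longrightarrow> x = y"
  unfolding lat_le_def by (metis meet_comm)

lemma le_eqI:
  assumes "x \<in> carrier A" "y \<in> carrier A" "\<And>w. w \<in> carrier A \<Longrightarrow> w \<preceq> x \<longleftrightarrow> w \<preceq> y"
  shows "x = y"
  using assms(3)[OF assms(1)] assms(3)[OF assms(2)] assms(1,2) by (simp add: le_refl le_antisym)

lemma meet_le: "\<lbrakk>x \<in> carrier A; y \<in> carrier A\<rbrakk> \<Longrightarrow> x \<^bold>\<and> y \<preceq> x \<and> x \<^bold>\<and> y \<preceq> y"
  unfolding lat_le_def by (metis meet_assoc meet_comm meet_closed lat_le_def le_refl)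

lemma le_meet_iff:
  assumes "x \<in> carrier A" "y \<in> carrier A" "z \<in> carrier A"
  shows "z \<preceq> x \<^bold>\<and> y \<longleftrightarrow> z \<preceq> x \<and> z \<preceq> y"
proof
  show "z \<preceq> x \<and> z \<preceq> y" if "z \<preceq> x \<^bold>\<and> y"
    using that meet_le[of x y] le_trans[of z "x \<^bold>\<and> y"] assms by simp
  show "z \<preceq> x \<^bold>\<and> y" if "z \<preceq> x \<and> z \<preceq> y"
    using that assms meet_assoc[of z x y] by (simp add: lat_le_def)
qed

lemma le_iff_join: "\<lbrakk>x \<in> carrier A; y \<in> carrier A\<rbrakk> \<Longrightarrow> x \<preceq> y \<longleftrightarrow> x \<^bold>\<or> y = y"
  unfolding lat_le_def by (metis join_absorb join_comm meet_absorb meet_comm)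

lemma le_join: "\<lbrakk>x \<in> carrier A; y \<in> carrier A\<rbrakk> \<Longrightarrow> x \<preceq> x \<^bold>\<or> y \<and> y \<preceq> x \<^bold>\<or> y"
  unfolding lat_le_def by (metis join_comm meet_absorb)

lemma join_le_iff:
  assumes "x \<in> carrier A" "y \<in> carrier A" "z \<in> carrier A"
  shows "x \<^bold>\<or> y \<preceq> z \<longleftrightarrow> x \<preceq> z \<and> y \<preceq> z"
proof
  show "x \<preceq> z \<and> y \<preceq> z" if "x \<^bold>\<or> y \<preceq> z"
    using that le_join[of x y] le_trans[of _ "x \<^bold>\<or> y" z] assms by simp
  show "x \<^bold>\<or> y \<preceq> z" if "x \<preceq> z \<and> y \<preceq> z"
    using that assms join_assoc[of x y z] by (simp add: le_iff_join join_closed)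
qed

lemma times_le_iff: "\<lbrakk>x \<in> carrier A; y \<in> carrier A; z \<in> carrier A\<rbrakk> \<Longrightarrow> x \<cdot> y \<preceq> z \<longleftrightarrow> y \<preceq> x \<setminus> z"
  using residual_left by blast

lemma ldiv_eq_rdiv: "\<lbrakk>x \<in> carrier A; y \<in> carrier A\<rbrakk> \<Longrightarrow> x \<setminus> y = y \<oslash> x"
  using residual_left residual_right times_comm by (intro le_eqI closed) metis+

lemma modus_ponens: "\<lbrakk>x \<in> carrier A; y \<in> carrier A\<rbrakk> \<Longrightarrow> x \<cdot> (x \<setminus> y) \<preceq> y"
  by (simp add: times_le_iff le_refl)

lemma times_mono1: 
  assumes "x \<preceq> y" "x \<in> carrier A" "y \<in> carrier A" "z \<in> carrier A" shows "z \<cdot> x \<preceq> z \<cdot> y"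
proof -
  have "y \<preceq> z \<setminus> (z \<cdot> y)" using assms times_le_iff[of z y "z \<cdot> y"] le_refl by simp
  then have "x \<preceq> z \<setminus> (z \<cdot> y)" using assms le_trans[of x y] by simp
  then show ?thesis using assms by (simp add: times_le_iff)
qed

lemma times_mono:
  assumes "x \<preceq> y" "u \<preceq> w" "x \<in> carrier A" "y \<in> carrier A" "u \<in> carrier A" "w \<in> carrier A"
  shows "x \<cdot> u \<preceq> y \<cdot> w"
proof -
  have "x \<cdot> u \<preceq> x \<cdot> w" using assms by (intro times_mono1)
  moreover have "x \<cdot> w \<preceq> y \<cdot> w" using assms times_mono1[of x y w] by (simp add: times_comm[of _ w])
  ultimately show ?thesis using assms le_trans[of "x \<cdot> u" "x \<cdot> w"] by simp
qed

lemma times_le_neut: "\<lbrakk>x \<preceq> \<epsilon>; y \<preceq> \<epsilon>; x \<in> carrier A; y \<in> carrier A\<rbrakk> \<Longrightarrow> x \<cdot> y \<preceq> \<epsilon>"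
  using times_mono[of x \<epsilon> y \<epsilon>] neut_times neut_closed by simp

lemma inv_le: "x \<in> carrier A \<Longrightarrow> x \<cdot> inv_elt x \<preceq> \<epsilon>"
  by (simp add: modus_ponens)

text \<open>The elements \<open>x \<cdot> (x \<setminus> \<epsilon>)\<close> are dense, i.e. mapped to the unit by double negation.\<close>

lemma dense_cancel:
  assumes "x \<in> carrier A" "y \<in> carrier A" "(x \<cdot> inv_elt x) \<cdot> y \<preceq> \<epsilon>"
  shows "y \<preceq> \<epsilon>"
proof -
  have "x \<cdot> (inv_elt x \<cdot> y) \<preceq> \<epsilon>" using assms by (simp add: times_assoc)
  then have "inv_elt x \<cdot> y \<preceq> inv_elt x" using assms by (simp add: times_le_iff)
  \<comment> \<open>Integral closure enters here: this division is the unit.\<close>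
  then have "y \<preceq> inv_elt x \<setminus> inv_elt x" using assms by (simp add: times_le_iff)
  then show ?thesis using assms by (simp add: ldiv_self)
qed

text \<open>The product of \<open>x\<close> with its inverse is below the unit. This approximates a
  division from below by a product, up to a dense factor.\<close>

lemma times_inv_le_ldiv:
  assumes "x \<in> carrier A" "y \<in> carrier A"
  shows "y \<cdot> inv_elt x \<preceq> x \<setminus> y"
proof -
  have "y \<cdot> (x \<cdot> inv_elt x) \<preceq> y \<cdot> \<epsilon>"
    using assms by (simp add: times_mono1 inv_le)
  then show ?thesis
    using assms times_le_iff[of x "y \<cdot> inv_elt x" y] by (simp add: times_lcomm[of x y] times_neut)
qed

text \<open>That \<epsilon> is below the left side is plain residuation. For the converse, replace
  the divisions by the smaller products of \<open>times_inv_le_ldiv\<close>; regrouping gives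
  \<open>z\<close> times two dense factors times \<open>?k\<close> below \<open>z\<close>, and these
  factors cancel since \<open>z \<setminus> z\<close> is the unit.\<close>

lemma transitivity:
  assumes "x \<in> carrier A" "y \<in> carrier A" "z \<in> carrier A"
  shows "(x \<setminus> y) \<setminus> ((y \<setminus> z) \<setminus> (x \<setminus> z)) = \<epsilon>" (is "?k = _")
proof (rule le_antisym)
  note c = assms
  have "x \<cdot> ((x \<setminus> y) \<cdot> (y \<setminus> z)) \<preceq> z"
  proof -
    have "x \<cdot> (x \<setminus> y) \<cdot> (y \<setminus> z) \<preceq> y \<cdot> (y \<setminus> z)"
      using c by (simp add: times_mono modus_ponens le_refl)
    then have "x \<cdot> (x \<setminus> y) \<cdot> (y \<setminus> z) \<preceq> z"
      using modus_ponens[of y z] c le_trans[of _ "y \<cdot> (y \<setminus> z)" z] by simp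
    then show ?thesis using c by (simp add: times_assoc)
  qed
  then have "(y \<setminus> z) \<cdot> (x \<setminus> y) \<preceq> x \<setminus> z"
    using c by (simp add: times_le_iff times_comm[of "x \<setminus> y"])
  then have "(x \<setminus> y) \<cdot> \<epsilon> \<preceq> (y \<setminus> z) \<setminus> (x \<setminus> z)" using c by (simp add: times_le_iff times_neut)
  then show "\<epsilon> \<preceq> ?k" using c by (simp add: times_le_iff)
  have k: "?k \<in> carrier A" using c by simp
  have "(x \<setminus> y) \<cdot> ?k \<preceq> (y \<setminus> z) \<setminus> (x \<setminus> z)" using c modus_ponens by simp
  then have "x \<cdot> ((y \<setminus> z) \<cdot> ((x \<setminus> y) \<cdot> ?k)) \<preceq> z" using c by (simp add: times_le_iff)
  moreover have "x \<cdot> ((z \<cdot> inv_elt y) \<cdot> ((y \<cdot> inv_elt x) \<cdot> ?k)) \<preceq> x \<cdot> ((y \<setminus> z) \<cdot> ((x \<setminus> y) \<cdot> ?k))"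
    using c by (simp add: times_mono le_refl times_inv_le_ldiv)
  ultimately have "x \<cdot> ((z \<cdot> inv_elt y) \<cdot> ((y \<cdot> inv_elt x) \<cdot> ?k)) \<preceq> z"
    using c k le_trans[of _ "x \<cdot> ((y \<setminus> z) \<cdot> ((x \<setminus> y) \<cdot> ?k))" z] by simp
  moreover have "x \<cdot> ((z \<cdot> inv_elt y) \<cdot> ((y \<cdot> inv_elt x) \<cdot> u))
      = z \<cdot> ((x \<cdot> inv_elt x) \<cdot> ((y \<cdot> inv_elt y) \<cdot> u))" if "u \<in> carrier A" for u
    using that c by (simp add: times_ac)
  ultimately have "z \<cdot> ((x \<cdot> inv_elt x) \<cdot> ((y \<cdot> inv_elt y) \<cdot> ?k)) \<preceq> z" using k by simp
  then have "(x \<cdot> inv_elt x) \<cdot> ((y \<cdot> inv_elt y) \<cdot> ?k) \<preceq> z \<setminus> z"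
    using k c by (simp add: times_le_iff)
  then have "(x \<cdot> inv_elt x) \<cdot> ((y \<cdot> inv_elt y) \<cdot> ?k) \<preceq> \<epsilon>" using c by (simp add: ldiv_self)
  then show "?k \<preceq> \<epsilon>" using c dense_cancel[of y ?k] dense_cancel[of x "(y \<cdot> inv_elt y) \<cdot> ?k"] by simp
qed (use assms in simp_all)

lemma sircomonoid_reduct: "sircomonoid A"
proof
  fix x y z assume c: "x \<in> carrier A" "y \<in> carrier A" "z \<in> carrier A"
  show "((x \<setminus> z) \<oslash> (y \<setminus> z)) \<oslash> (x \<setminus> y) = \<epsilon>" "(y \<oslash> x) \<setminus> ((z \<oslash> y) \<setminus> (z \<oslash> x)) = \<epsilon>"
    using c transitivity by (simp_all add: ldiv_eq_rdiv[symmetric] closed)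
  show "(x \<cdot> y) \<setminus> z = y \<setminus> (x \<setminus> z)"
    using c by (intro le_eqI closed) (simp_all add: times_le_iff[symmetric] times_assoc closed)
next
  fix x assume c: "x \<in> carrier A"
  show e: "\<epsilon> \<setminus> x = x"
    using c by (intro le_eqI closed) (simp_all add: times_le_iff[symmetric] neut_times closed)
  show "x \<oslash> \<epsilon> = x" using e c by (simp add: ldiv_eq_rdiv[symmetric] neut_closed)
next
  fix x y assume c: "x \<in> carrier A" "y \<in> carrier A" "x \<setminus> y = \<epsilon>" "y \<setminus> x = \<epsilon>"
  have "x \<cdot> \<epsilon> \<preceq> y" "y \<cdot> \<epsilon> \<preceq> x" using c by (simp_all add: times_le_iff le_refl closed)
  then show "x = y" using c le_antisym by (simp add: times_neut)
qed (simp_all add: closed ldiv_eq_rdiv)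

text \<open>By residuation, \<open>x\<close> lies below the double inverse of
  \<open>y\<close>.\<close>

abbreviation deg_le :: "'a \<Rightarrow> 'a \<Rightarrow> bool" where "deg_le x y \<equiv> x \<cdot> inv_elt y \<preceq> \<epsilon>"

lemma inv_times_le:
  assumes "x \<in> carrier A" "y \<in> carrier A"
  shows "inv_elt x \<cdot> inv_elt y \<preceq> inv_elt (x \<cdot> y)"
proof -
  have "(x \<cdot> inv_elt x) \<cdot> (y \<cdot> inv_elt y) \<preceq> \<epsilon>"
    using assms by (simp add: times_le_neut inv_le)
  then have "(x \<cdot> y) \<cdot> (inv_elt x \<cdot> inv_elt y) \<preceq> \<epsilon>"
    using assms by (simp add: times_ac closed)
  then show ?thesis using assms by (simp add: times_le_iff closed)
qed

lemma deg_le_of_le: "\<lbrakk>x \<preceq> y; x \<in> carrier A; y \<in> carrier A\<rbrakk> \<Longrightarrow> deg_le x y"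
  using times_mono[of x y "inv_elt y" "inv_elt y"] inv_le[of y]
    le_trans[of "x \<cdot> inv_elt y" "y \<cdot> inv_elt y" \<epsilon>] by (simp add: le_refl)

text \<open>Multiply both hypotheses with \<open>(y \<cdot> w) \<cdot> ?k\<close>, which is below
  the unit; after regrouping, the dense factors of \<open>y\<close> and \<open>w\<close>
  cancel.\<close>

lemma deg_le_times:
  assumes "deg_le x y" "deg_le u w" "x \<in> carrier A" "y \<in> carrier A" "u \<in> carrier A" "w \<in> carrier A"
  shows "deg_le (x \<cdot> u) (y \<cdot> w)"
proof -
  let ?k = "inv_elt (y \<cdot> w)"
  note c = assms(3-)
  have k: "?k \<in> carrier A" using c by simp
  have "(x \<cdot> inv_elt y) \<cdot> ((u \<cdot> inv_elt w) \<cdot> ((y \<cdot> w) \<cdot> ?k)) \<preceq> \<epsilon>"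
    using assms by (simp add: times_le_neut inv_le)
  moreover have "(x \<cdot> inv_elt y) \<cdot> ((u \<cdot> inv_elt w) \<cdot> ((y \<cdot> w) \<cdot> k))
      = (y \<cdot> inv_elt y) \<cdot> ((w \<cdot> inv_elt w) \<cdot> ((x \<cdot> u) \<cdot> k))" if "k \<in> carrier A" for k
    using that c by (simp add: times_ac)
  ultimately have "(y \<cdot> inv_elt y) \<cdot> ((w \<cdot> inv_elt w) \<cdot> ((x \<cdot> u) \<cdot> ?k)) \<preceq> \<epsilon>" using k by simp
  then show ?thesis using c dense_cancel[of w "(x \<cdot> u) \<cdot> ?k"]
      dense_cancel[of y "(w \<cdot> inv_elt w) \<cdot> ((x \<cdot> u) \<cdot> ?k)"] by simp
qed

lemma deg_le_cancel:
  assumes "deg_le (x \<cdot> z) (y \<cdot> z)" "x \<in> carrier A" "y \<in> carrier A" "z \<in> carrier A"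
  shows "deg_le x y"
proof -
  note c = assms(2-)
  have "(x \<cdot> z) \<cdot> (inv_elt y \<cdot> inv_elt z) \<preceq> (x \<cdot> z) \<cdot> inv_elt (y \<cdot> z)"
    using c by (simp add: times_mono1 inv_times_le)
  then have "(x \<cdot> z) \<cdot> (inv_elt y \<cdot> inv_elt z) \<preceq> \<epsilon>"
    using assms(1) c le_trans[of _ "(x \<cdot> z) \<cdot> inv_elt (y \<cdot> z)" \<epsilon>] by simp
  then have "(z \<cdot> inv_elt z) \<cdot> (x \<cdot> inv_elt y) \<preceq> \<epsilon>" using c by (simp add: times_ac)
  then show ?thesis using dense_cancel[of z "x \<cdot> inv_elt y"] c by simp
qed

text \<open>Multiplying \<open>w\<close> by dense elements yields \<open>?d\<close>, which is truly
  below both \<open>x\<close> and \<open>y\<close>; the dense factors cancel again in the comparison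
  of degrees.\<close>

lemma deg_le_meet:
  assumes "deg_le w x" "deg_le w y" "x \<in> carrier A" "y \<in> carrier A" "w \<in> carrier A"
  shows "deg_le w (x \<^bold>\<and> y)"
proof -
  note c = assms(3-)
  let ?d = "(x \<cdot> inv_elt x) \<cdot> ((y \<cdot> inv_elt y) \<cdot> w)"
  have d: "?d \<in> carrier A" using c by simp
  have "x \<cdot> ((w \<cdot> inv_elt x) \<cdot> (y \<cdot> inv_elt y)) \<preceq> x \<cdot> \<epsilon>" 
    using assms by (simp add: times_mono1 times_le_neut inv_le)
  then have dx: "?d \<preceq> x" using c by (simp add: times_ac times_neut)
  have "y \<cdot> ((w \<cdot> inv_elt y) \<cdot> (x \<cdot> inv_elt x)) \<preceq> y \<cdot> \<epsilon>" 
    using assms by (simp add: times_mono1 times_le_neut inv_le)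
  then have "?d \<preceq> y" using c by (simp add: times_ac times_neut)
  then have "?d \<preceq> x \<^bold>\<and> y" using dx c d by (simp add: le_meet_iff)
  then have "deg_le ?d (x \<^bold>\<and> y)" using c d by (simp add: deg_le_of_le)
  then have "(x \<cdot> inv_elt x) \<cdot> ((y \<cdot> inv_elt y) \<cdot> (w \<cdot> inv_elt (x \<^bold>\<and> y))) \<preceq> \<epsilon>"
    using c by (simp add: times_assoc)
  then show ?thesis using c dense_cancel[of y "w \<cdot> inv_elt (x \<^bold>\<and> y)"]
      dense_cancel[of x "(y \<cdot> inv_elt y) \<cdot> (w \<cdot> inv_elt (x \<^bold>\<and> y))"] by simp
qed

lemma deg_le_trans:
  assumes "deg_le x y" "deg_le y z" "x \<in> carrier A" "y \<in> carrier A" "z \<in> carrier A"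
  shows "deg_le x z"
  using deg_le_times[OF assms(1,2)] assms(3-) deg_le_cancel[of x y z] by (simp add: times_comm[of y z])

text \<open>Since \<open>k \<cdot> inv_elt k\<close> has the degree of the unit, \<open>k\<close>
  can be moved to the other side, \<open>deg_le_meet\<close> applied and \<open>k\<close> moved
  back.\<close>

lemma deg_le_meet_times:
  assumes "deg_le h (x \<cdot> k)" "deg_le h (y \<cdot> k)"
    "h \<in> carrier A" "x \<in> carrier A" "y \<in> carrier A" "k \<in> carrier A"
  shows "deg_le h ((x \<^bold>\<and> y) \<cdot> k)"
proof -
  note c = assms(3-)
  have dense: "deg_le (k \<cdot> inv_elt k) \<epsilon>" "deg_le \<epsilon> (k \<cdot> inv_elt k)"
  proof -
    show "deg_le (k \<cdot> inv_elt k) \<epsilon>" using c inv_le deg_le_of_le by simp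
    have "(k \<cdot> inv_elt k) \<cdot> inv_elt (k \<cdot> inv_elt k) \<preceq> \<epsilon>" using c by (simp add: inv_le)
    then have "inv_elt (k \<cdot> inv_elt k) \<preceq> \<epsilon>" using c dense_cancel[of k] by simp
    then show "deg_le \<epsilon> (k \<cdot> inv_elt k)" using c by (simp add: neut_times)
  qed
  have step: "deg_le (h \<cdot> inv_elt k) u" if "deg_le h (u \<cdot> k)" "u \<in> carrier A" for u
  proof -
    have "deg_le (h \<cdot> inv_elt k) ((u \<cdot> k) \<cdot> inv_elt k)"
      using that c by (simp add: deg_le_times deg_le_of_le le_refl)
    moreover have "deg_le (u \<cdot> (k \<cdot> inv_elt k)) (u \<cdot> \<epsilon>)"
      using that c dense by (simp add: deg_le_times deg_le_of_le le_refl)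
    ultimately show ?thesis
      using that c deg_le_trans[of "h \<cdot> inv_elt k" "u \<cdot> (k \<cdot> inv_elt k)" u]
      by (simp add: times_assoc times_neut)
  qed
  have "deg_le (h \<cdot> inv_elt k) (x \<^bold>\<and> y)"
    using assms by (simp add: deg_le_meet step)
  then have "deg_le ((h \<cdot> inv_elt k) \<cdot> k) ((x \<^bold>\<and> y) \<cdot> k)"
    using c by (simp add: deg_le_times deg_le_of_le le_refl)
  moreover have "deg_le (h \<cdot> \<epsilon>) (h \<cdot> (k \<cdot> inv_elt k))"
    using c dense by (simp add: deg_le_times deg_le_of_le le_refl)
  moreover have "(h \<cdot> inv_elt k) \<cdot> k = h \<cdot> (k \<cdot> inv_elt k)"
    using c by (simp add: times_ac)
  ultimately show ?thesis
    using c deg_le_trans[of h "h \<cdot> (k \<cdot> inv_elt k)" "(x \<^bold>\<and> y) \<cdot> k"] by (simp add: times_neut)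
qed

lemma deg_le_ldiv: "\<lbrakk>x \<in> carrier A; y \<in> carrier A\<rbrakk> \<Longrightarrow> deg_le (x \<cdot> (x \<setminus> y)) y"
  by (simp add: modus_ponens deg_le_of_le)

text \<open>Multiplying \<open>times_inv_le_ldiv\<close> by \<open>x\<close> leaves one dense factor
  to cancel. Together with \<open>deg_le_ldiv\<close>, division subtracts degrees exactly.\<close>

lemma deg_ge_ldiv:
  assumes "x \<in> carrier A" "y \<in> carrier A" shows "deg_le y (x \<cdot> (x \<setminus> y))"
proof -
  note c = assms
  have "x \<cdot> (y \<cdot> inv_elt x) \<preceq> x \<cdot> (x \<setminus> y)"
    using c by (simp add: times_mono1 times_inv_le_ldiv)
  then have "deg_le (x \<cdot> (y \<cdot> inv_elt x)) (x \<cdot> (x \<setminus> y))"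
    using c by (simp add: deg_le_of_le)
  moreover have "(x \<cdot> (y \<cdot> inv_elt x)) \<cdot> u = (x \<cdot> inv_elt x) \<cdot> (y \<cdot> u)" if "u \<in> carrier A" for u
    using c that by (simp add: times_ac)
  ultimately have "(x \<cdot> inv_elt x) \<cdot> (y \<cdot> inv_elt (x \<cdot> (x \<setminus> y))) \<preceq> \<epsilon>" using c by simp
  then show ?thesis using c dense_cancel[of x] by simp
qed

end

section \<open>The sequent frame of lattice terms\<close>

locale lattice_valuation = comm_integrally_closed_residuated_lattice A
  for A :: "('a, 'm) lattice_div_alg_scheme" (structure) +
  fixes val :: "nat \<Rightarrow> 'a"
  assumes val_closed: "range val \<subseteq> carrier A"
begin

abbreviation eval :: "lattice_div_term \<Rightarrow> 'a" where "eval \<equiv> lattice_div_eval A val"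

lemma eval_closed [simp]: "eval t \<in> carrier A"
  using val_closed by (induction t) auto

text \<open>The guard makes the steps commute also off the carrier, as \<open>fold_mset\<close>
  requires.\<close>

definition prod :: "lattice_div_term multiset \<Rightarrow> 'a" where
  "prod G = fold_mset (\<lambda>t c. if c \<in> carrier A then eval t \<cdot> c else c) \<epsilon> G"

lemma prod_commute: "comp_fun_commute (\<lambda>t c. if c \<in> carrier A then eval t \<cdot> c else c)"
proof
  show "(\<lambda>c. if c \<in> carrier A then eval j \<cdot> c else c) \<circ> (\<lambda>c. if c \<in> carrier A then eval i \<cdot> c else c)
    = (\<lambda>c. if c \<in> carrier A then eval i \<cdot> c else c) \<circ> (\<lambda>c. if c \<in> carrier A then eval j \<cdot> c else c)" for i j
    by (auto simp: fun_eq_iff times_lcomm[of "eval j" "eval i"])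
qed

lemma prod_empty [simp]: "prod {#} = \<epsilon>"
  by (simp add: prod_def)

lemma prod_closed [simp]: "prod G \<in> carrier A"
  unfolding prod_def
  by (induction G) (simp_all add: comp_fun_commute.fold_mset_add_mset[OF prod_commute])

lemma prod_add_mset [simp]: "prod (add_mset t G) = eval t \<cdot> prod G"
  using prod_closed[of G] unfolding prod_def
  by (simp add: comp_fun_commute.fold_mset_add_mset[OF prod_commute])

lemma prod_union [simp]: "prod (G + D) = prod G \<cdot> prod D"
  by (induction G) (simp_all add: neut_times times_assoc)

definition ded :: "lattice_div_term multiset \<Rightarrow> lattice_div_term \<Rightarrow> bool" where
  "ded G t \<longleftrightarrow> prod G \<preceq> eval t"

definition dle :: "lattice_div_term multiset \<Rightarrow> lattice_div_term multiset \<Rightarrow> bool" where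
  "dle G D \<longleftrightarrow> deg_le (prod G) (prod D)"

text \<open>The unit is its own inverse. Hence nonpositive degree is a true inequality, as weakening
  requires.\<close>

lemma deg_le_neut: "x \<in> carrier A \<Longrightarrow> deg_le x \<epsilon> \<longleftrightarrow> x \<preceq> \<epsilon>"
  by (simp add: ldiv_self times_neut)

sublocale seq: sequent_frame ded dle
proof
  fix G D H G' D' :: "lattice_div_term multiset" and s t :: lattice_div_term
  show "dle G G" by (simp add: dle_def inv_le)
  show "dle (G + G') (D + D')" if "dle G D" "dle G' D'"
    using that by (simp add: dle_def deg_le_times)
  show "dle G D" if "dle (G + H) (D + H)"
    using that deg_le_cancel[of "prod G" "prod H" "prod D"] by (simp add: dle_def)
  show "\<exists>F. dle F G \<and> dle F D \<and> (\<forall>H K. dle H (G + K) \<longrightarrow> dle H (D + K) \<longrightarrow> dle H (F + K))"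
  proof -
    \<comment> \<open>Every product of values is the value of one term, so the required meet is a
      singleton \<open>LMeet\<close>.\<close>
    have "\<exists>u. eval u = prod G" for G
    proof (induction G)
      case empty
      show ?case by (rule exI[of _ LNeut]) simp
    next
      case (add t G)
      then show ?case by (metis lattice_div_eval.simps(5) prod_add_mset)
    qed
    then obtain u w where uw: "eval u = prod G" "eval w = prod D" by metis
    have "prod {#LMeet u w#} = prod G \<^bold>\<and> prod D" by (simp add: uw times_neut)
    then show ?thesis
      using meet_le[of "prod G" "prod D"]
      by (intro exI[of _ "{#LMeet u w#}"]) (simp only: dle_def prod_union, simp add: deg_le_of_le deg_le_meet_times)
  qed
  show "ded (G + H) t" if "ded G t" "dle H {#}"
    using that times_mono[of "prod G" "eval t" "prod H" \<epsilon>]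
    by (simp add: ded_def dle_def deg_le_neut times_neut)
  show "dle G {#t#}" if "ded G t"
    using that by (simp add: ded_def dle_def deg_le_of_le times_neut)
  show "ded {#t#} t" by (simp add: ded_def times_neut le_refl)
  show "ded (G + D) t" if "ded G s" "ded (D + {#s#}) t"
    using that times_mono1[of "prod G" "eval s" "prod D"] le_trans[of _ "prod D \<cdot> eval s" "eval t"]
    by (simp add: ded_def times_neut times_comm[of _ "prod D"])
qed

lemma interp_eq_imp: "seq.interp s = seq.interp t \<Longrightarrow> eval s = eval t"
  using seq.interp_ded[of s t] seq.interp_ded[of t s] by (simp add: ded_def times_neut le_antisym)

lemma interp_ldiv:
  assumes "eval u = eval s \<setminus> eval t"
  shows "seq.interp u = seq.residual (seq.interp s) (seq.interp t)"
proof (rule seq.interp_residual)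
  show "ded G u \<longleftrightarrow> ded (add_mset s G) t" for G
    by (simp add: ded_def assms times_le_iff)
  \<comment> \<open>The terms \<open>s\<close> and \<open>u\<close> together have the same degree as
    \<open>t\<close>.\<close>
  have su: "dle {#s, u#} {#t#}" "dle {#t#} {#s, u#}"
    by (simp_all add: dle_def assms deg_le_ldiv deg_ge_ldiv times_neut)
  show "dle G (add_mset u D) \<longleftrightarrow> dle (add_mset s G) (add_mset t D)" for G D
  proof
    assume "dle G (add_mset u D)"
    then have "dle (G + {#s#}) (add_mset u D + {#s#})" by (simp only: seq.dle_cancel_iff)
    moreover have "dle ({#s, u#} + D) ({#t#} + D)" using su(1) by (simp only: seq.dle_cancel_iff)
    ultimately show "dle (add_mset s G) (add_mset t D)"
      using seq.dle_trans by (simp add: add_mset_commute)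
  next
    assume "dle (add_mset s G) (add_mset t D)"
    moreover have "dle ({#t#} + D) ({#s, u#} + D)" using su(2) by (simp only: seq.dle_cancel_iff)
    ultimately have "dle (add_mset s G) (add_mset s (add_mset u D))"
      using seq.dle_trans by simp
    then show "dle G (add_mset u D)" using seq.dle_cancel_iff[of G "{#s#}" "add_mset u D"] by simp
  qed
qed

lemma interp_hom:
  "lattice_div_eval seq.frame_alg (\<lambda>i. seq.interp (LVar i)) t = seq.interp t"
proof (induction t)
  case LNeut
  have "seq.interp LNeut = {w. seq.le w 0}"
    by (rule seq.interp_neut) (simp_all add: ded_def dle_def neut_times)
  then show ?case by (simp add: seq.frame_alg_def)
next
  case (LLdiv s t)
  then show ?case using interp_ldiv[of "LLdiv s t" s t] by (simp add: seq.frame_alg_def)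
next
  case (LRdiv s t)
  then show ?case using interp_ldiv[of "LRdiv s t" t s] by (simp add: seq.frame_alg_def ldiv_eq_rdiv)
next
  case (LTimes s t)
  have "seq.interp (LTimes s t) = seq.perp (seq.perp (seq.setadd (seq.interp s) (seq.interp t)))"
    by (rule seq.interp_times) (simp_all add: ded_def dle_def times_assoc)
  then show ?case using LTimes by (simp add: seq.frame_alg_def)
next
  case (LMeet s t)
  have "seq.interp (LMeet s t) = seq.interp s \<inter> seq.interp t"
  proof (rule seq.interp_meet)
    show "dle G (add_mset (LMeet s t) D) \<longleftrightarrow> dle G (add_mset s D) \<and> dle G (add_mset t D)" for G D
    proof
      assume G: "dle G (add_mset (LMeet s t) D)"
      have "dle ({#LMeet s t#} + D) ({#s#} + D)" "dle ({#LMeet s t#} + D) ({#t#} + D)"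
        unfolding seq.dle_cancel_iff using meet_le[of "eval s" "eval t"]
        by (simp_all add: dle_def deg_le_of_le times_neut)
      then show "dle G (add_mset s D) \<and> dle G (add_mset t D)"
        using G seq.dle_trans by simp
    qed (simp add: dle_def deg_le_meet_times)
  qed (simp add: ded_def le_meet_iff)
  then show ?case using LMeet by (simp add: seq.frame_alg_def)
next
  case (LJoin s t)
  \<comment> \<open>Multiplication distributes over joins by residuation; this also covers degrees,
    being inequalities with bound \<epsilon>.\<close>
  have join: "(eval s \<^bold>\<or> eval t) \<cdot> x \<preceq> y \<longleftrightarrow> eval s \<cdot> x \<preceq> y \<and> eval t \<cdot> x \<preceq> y"
    if "x \<in> carrier A" "y \<in> carrier A" for x y
    using that by (simp add: times_comm[of _ x] times_le_iff join_le_iff)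
  have "seq.interp (LJoin s t) = seq.perp (seq.perp (seq.interp s) \<inter> seq.perp (seq.interp t))"
    by (rule seq.interp_join) (simp_all add: ded_def dle_def join times_assoc)
  then show ?case using LJoin by (simp add: seq.frame_alg_def)
qed simp

end

lemma lattice_frame_counterexample:
  assumes "comm_integrally_closed_residuated_lattice B" "\<not> lattice_div_valid B s t"
  shows "\<exists>A :: (lattice_div_term multiset \<times> lattice_div_term multiset) set pointed_lattice_div_alg.
    casari_algebra A \<and> \<not> lattice_div_valid A s t"
proof -
  obtain v where v: "range v \<subseteq> carrier B" "lattice_div_eval B v s \<noteq> lattice_div_eval B v t"
    using assms(2) by (auto simp: lattice_div_valid_def)
  interpret lattice_valuation B v
    using assms(1) v(1) by (simp add: lattice_valuation_def lattice_valuation_axioms_def)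
  have "range (\<lambda>i. seq.interp (LVar i)) \<subseteq> carrier seq.frame_alg"
    using seq.graded_interp by (auto simp: seq.frame_alg_def)
  then have "\<not> lattice_div_valid seq.frame_alg s t"
    using v(2) interp_eq_imp unfolding lattice_div_valid_def by (metis interp_hom)
  then show ?thesis using seq.casari_frame_alg by blast
qed

section \<open>Change of the underlying type\<close>

instance div_term :: countable by countable_datatype
instance mult_div_term :: countable by countable_datatype
instance lattice_div_term :: countable by countable_datatype

lemma countable_inj_on_ex:
  assumes "countable X" "infinite (UNIV :: 'b set)"
  shows "\<exists>g :: 'a \<Rightarrow> 'b. inj_on g X"
proof -
  obtain f :: "nat \<Rightarrow> 'b" where f: "inj f"
    using infinite_countable_subset[OF assms(2)] by blast
  have "inj_on (f \<circ> to_nat_on X) X"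
    using inj_on_to_nat_on[OF assms(1)] f by (metis comp_inj_on inj_on_subset subset_UNIV)
  then show ?thesis by blast
qed

text \<open>A subalgebra \<open>X\<close> is copied into another type along a map that is injective
  on it.\<close>

locale casari_transport = casari_algebra A for A :: "('a, 'm) pointed_lattice_div_alg_scheme" (structure) +
  fixes X :: "'a set" and g :: "'a \<Rightarrow> 'b"
  assumes sub: "X \<subseteq> carrier A"
    and inj: "inj_on g X"
    and sub_closed [simp]: "\<epsilon> \<in> X" "\<phi> \<in> X"
      "\<And>x y. \<lbrakk>x \<in> X; y \<in> X\<rbrakk> \<Longrightarrow> x \<setminus> y \<in> X" "\<And>x y. \<lbrakk>x \<in> X; y \<in> X\<rbrakk> \<Longrightarrow> x \<oslash> y \<in> X"
      "\<And>x y. \<lbrakk>x \<in> X; y \<in> X\<rbrakk> \<Longrightarrow> x \<cdot> y \<in> X" "\<And>x y. \<lbrakk>x \<in> X; y \<in> X\<rbrakk> \<Longrightarrow> x \<^bold>\<and> y \<in> X"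
      "\<And>x y. \<lbrakk>x \<in> X; y \<in> X\<rbrakk> \<Longrightarrow> x \<^bold>\<or> y \<in> X"
begin

abbreviation lift2 :: "('a \<Rightarrow> 'a \<Rightarrow> 'a) \<Rightarrow> 'b \<Rightarrow> 'b \<Rightarrow> 'b" where
  "lift2 p \<equiv> \<lambda>x y. g (p (inv_into X g x) (inv_into X g y))"

definition img :: "'b pointed_lattice_div_alg" where
  "img = \<lparr>carrier = g ` X, ldiv = lift2 (ldiv A), rdiv = lift2 (rdiv A), neut = g \<epsilon>,
     times_op = lift2 (times_op A), meet_op = lift2 (meet_op A), join_op = lift2 (join_op A),
     fpoint = g \<phi>\<rparr>"

lemma inv_g [simp]: "x \<in> X \<Longrightarrow> inv_into X g (g x) = x"
  by (rule inv_into_f_f[OF inj])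

lemma g_eq_iff [simp]: "\<lbrakk>x \<in> X; y \<in> X\<rbrakk> \<Longrightarrow> g x = g y \<longleftrightarrow> x = y"
  using inj by (simp add: inj_on_eq_iff)

lemma mem_carrier [simp]: "x \<in> X \<Longrightarrow> x \<in> carrier A"
  using sub by blast

lemma img_simps [simp]:
  "carrier img = g ` X" "\<epsilon>\<^bsub>img\<^esub> = g \<epsilon>" "\<phi>\<^bsub>img\<^esub> = g \<phi>"
  "\<lbrakk>x \<in> X; y \<in> X\<rbrakk> \<Longrightarrow> g x \<setminus>\<^bsub>img\<^esub> g y = g (x \<setminus> y)"
  "\<lbrakk>x \<in> X; y \<in> X\<rbrakk> \<Longrightarrow> g x \<oslash>\<^bsub>img\<^esub> g y = g (x \<oslash> y)"
  "\<lbrakk>x \<in> X; y \<in> X\<rbrakk> \<Longrightarrow> g x \<cdot>\<^bsub>img\<^esub> g y = g (x \<cdot> y)"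
  "\<lbrakk>x \<in> X; y \<in> X\<rbrakk> \<Longrightarrow> g x \<^bold>\<and>\<^bsub>img\<^esub> g y = g (x \<^bold>\<and> y)"
  "\<lbrakk>x \<in> X; y \<in> X\<rbrakk> \<Longrightarrow> g x \<^bold>\<or>\<^bsub>img\<^esub> g y = g (x \<^bold>\<or> y)"
  by (simp_all add: img_def)

lemma lat_le_img [simp]: "\<lbrakk>x \<in> X; y \<in> X\<rbrakk> \<Longrightarrow> g x \<preceq>\<^bsub>img\<^esub> g y \<longleftrightarrow> x \<preceq> y"
  by (simp add: lat_le_def)

lemma neg_img [simp]: "x \<in> X \<Longrightarrow> neg img (g x) = g (neg A x)" "x \<in> X \<Longrightarrow> neg A x \<in> X"
  by (simp_all add: neg_def)

lemma casari_img: "casari_algebra img"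
proof -
  have "\<And>x y z. \<lbrakk>x \<in> carrier A; y \<in> carrier A; z \<in> carrier A\<rbrakk> \<Longrightarrow> x \<cdot> y \<cdot> z = x \<cdot> (y \<cdot> z)"
    "\<And>x. x \<in> carrier A \<Longrightarrow> \<epsilon> \<cdot> x = x" "\<And>x. x \<in> carrier A \<Longrightarrow> x \<cdot> \<epsilon> = x"
    using monoid.m_assoc[OF monoid] monoid.l_one[OF monoid] monoid.r_one[OF monoid] by simp_all
  note mon = this
  have "monoid \<lparr>carrier = carrier img, monoid.mult = times_op img, one = neut img\<rparr>"
    by (rule monoidI) (auto simp: mon)
  then have "residuated_lattice img"
    by (rule residuated_lattice.intro)
      (auto simp: meet_absorb join_absorb residual_left residual_right meet_assoc join_assoc,
        simp_all add: meet_comm join_comm)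
  then interpret B: residuated_lattice img .
  show ?thesis
    by unfold_locales
      (auto simp: ldiv_self rdiv_self involutive fpoint_ldiv_neut, simp add: times_comm)
qed

lemma div_eval_img: "range v \<subseteq> X \<Longrightarrow> div_eval img (g \<circ> v) t = g (div_eval A v t) \<and> div_eval A v t \<in> X"
  by (induction t) auto

lemma mult_div_eval_img:
  "range v \<subseteq> X \<Longrightarrow> mult_div_eval img (g \<circ> v) t = g (mult_div_eval A v t) \<and> mult_div_eval A v t \<in> X"
  by (induction t) auto

lemma lattice_div_eval_img:
  "range v \<subseteq> X \<Longrightarrow> lattice_div_eval img (g \<circ> v) t = g (lattice_div_eval A v t) \<and> lattice_div_eval A v t \<in> X"
  by (induction t) auto

end

text \<open>The subalgebra generated by the assignment and the point is the image of the countably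
  many terms, hence embeds into any infinite type. One assignment \<open>w\<close> serves all three
  signatures.\<close>

lemma casari_transfer:
  fixes A :: "('a, 'm) pointed_lattice_div_alg_scheme"
  assumes "casari_algebra A" "range v \<subseteq> carrier A" "infinite (UNIV :: 'b set)"
  shows "\<exists>(C :: 'b pointed_lattice_div_alg) w. casari_algebra C \<and> range w \<subseteq> carrier C \<and>
    (\<forall>s t. div_eval C w s = div_eval C w t \<longrightarrow> div_eval A v s = div_eval A v t) \<and>
    (\<forall>s t. mult_div_eval C w s = mult_div_eval C w t \<longrightarrow> mult_div_eval A v s = mult_div_eval A v t) \<and>
    (\<forall>s t. lattice_div_eval C w s = lattice_div_eval C w t \<longrightarrow> lattice_div_eval A v s = lattice_div_eval A v t)"
proof -
  interpret casari_algebra A by (rule assms(1))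
  \<comment> \<open>The terms have no symbol for \<open>f\<close>, so variable 0 takes its place.\<close>
  define u where "u = case_nat \<phi>\<^bsub>A\<^esub> v"
  define X where "X = range (lattice_div_eval A u)"
  have u: "u n \<in> carrier A" for n
    using fpoint_closed assms(2) by (auto simp: u_def split: nat.split)
  have X: "lattice_div_eval A u t \<in> X" for t by (simp add: X_def)
  have mem: "v n \<in> X" "\<phi>\<^bsub>A\<^esub> \<in> X" "\<epsilon>\<^bsub>A\<^esub> \<in> X" for n
    using X[of "LVar (Suc n)"] X[of "LVar 0"] X[of LNeut] by (simp_all add: u_def)
  have "countable X" by (simp add: X_def)
  then obtain g :: "'a \<Rightarrow> 'b" where g: "inj_on g X" using countable_inj_on_ex assms(3) by metis
  have eval: "lattice_div_eval A u t \<in> carrier A" for t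
    using u monoid.m_closed[OF monoid] monoid.one_closed[OF monoid]
    by (induction t) (simp_all add: ldiv_closed rdiv_closed meet_closed join_closed)
  interpret casari_transport A X g
  proof
    show "X \<subseteq> carrier A" using eval by (auto simp: X_def)
    fix x y assume "x \<in> X" "y \<in> X"
    then obtain s t where "x = lattice_div_eval A u s" "y = lattice_div_eval A u t"
      by (auto simp: X_def)
    then show "x \<setminus>\<^bsub>A\<^esub> y \<in> X" "x \<oslash>\<^bsub>A\<^esub> y \<in> X" "x \<cdot>\<^bsub>A\<^esub> y \<in> X" "x \<^bold>\<and>\<^bsub>A\<^esub> y \<in> X" "x \<^bold>\<or>\<^bsub>A\<^esub> y \<in> X"
      using X[of "LLdiv s t"] X[of "LRdiv s t"] X[of "LTimes s t"] X[of "LMeet s t"] X[of "LJoin s t"]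
      by simp_all
  qed (use g mem in auto)
  have v: "range v \<subseteq> X" using mem by auto
  show ?thesis
    by (rule exI[of _ img], rule exI[of _ "g \<circ> v"])
      (use v casari_img div_eval_img[OF v] mult_div_eval_img[OF v] lattice_div_eval_img[OF v] in auto)
qed

lemma casari_transfer_valid:
  fixes A :: "('a, 'm) pointed_lattice_div_alg_scheme"
  assumes "casari_algebra A" "infinite (UNIV :: 'b set)"
  shows "\<not> div_valid A s1 t1 \<Longrightarrow> \<exists>C :: 'b pointed_lattice_div_alg. casari_algebra C \<and> \<not> div_valid C s1 t1"
    and "\<not> mult_div_valid A s2 t2 \<Longrightarrow> \<exists>C :: 'b pointed_lattice_div_alg. casari_algebra C \<and> \<not> mult_div_valid C s2 t2"
    and "\<not> lattice_div_valid A s3 t3 \<Longrightarrow> \<exists>C :: 'b pointed_lattice_div_alg. casari_algebra C \<and> \<not> lattice_div_valid C s3 t3"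
  unfolding div_valid_def mult_div_valid_def lattice_div_valid_def
  using casari_transfer[OF assms(1) _ assms(2)] by metis+

section \<open>Reducts of Casari algebras to the smaller signatures\<close>

lemma casari_lattice_reduct:
  assumes "casari_algebra C"
  shows "comm_integrally_closed_residuated_lattice (lattice_div_alg.truncate C)"
proof -
  interpret casari_algebra C by (rule assms)
  have le: "lat_le (lattice_div_alg.truncate C) = lat_le C"
    by (simp add: lat_le_def lattice_div_alg.defs fun_eq_iff)
  show ?thesis
    using comm_integrally_closed_residuated_lattice_axioms
    unfolding comm_integrally_closed_residuated_lattice_def integrally_closed_residuated_lattice_def
      residuated_lattice_def comm_integrally_closed_residuated_lattice_axioms_def
      integrally_closed_residuated_lattice_axioms_def
      lattice_div_alg.defs partial_object.simps div_alg.simps mult_div_alg.simps lattice_div_alg.simps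
    unfolding le[unfolded lattice_div_alg.defs] .
qed

lemma casari_mult_div_reduct:
  assumes "casari_algebra C" shows "sircomonoid (mult_div_alg.truncate C)"
proof -
  interpret casari_algebra C by (rule assms)
  show ?thesis
    using sircomonoid_reduct
    unfolding sircomonoid_def sirmonoid_def pseudo_bci_algebra_def sircomonoid_axioms_def sirmonoid_axioms_def
      mult_div_alg.defs partial_object.simps div_alg.simps mult_div_alg.simps .
qed

lemma casari_div_reduct:
  assumes "casari_algebra C" shows "bci_algebra (div_alg.truncate C)"
proof -
  interpret casari_algebra C by (rule assms)
  show ?thesis
    using sircomonoid.bci_reduct[OF sircomonoid_reduct]
    unfolding bci_algebra_def pseudo_bci_algebra_def bci_algebra_axioms_def
      div_alg.defs partial_object.simps div_alg.simps .
qed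

text \<open>The three classes range over records of exactly the smaller signature; evaluation reads
  only the fields that truncation keeps.\<close>

lemma truncate_valid:
  "lattice_div_valid (lattice_div_alg.truncate C) s1 t1 \<longleftrightarrow> lattice_div_valid C s1 t1"
  "mult_div_valid (mult_div_alg.truncate C) s2 t2 \<longleftrightarrow> mult_div_valid C s2 t2"
  "div_valid (div_alg.truncate C) s3 t3 \<longleftrightarrow> div_valid C s3 t3"
proof -
  have "lattice_div_eval (lattice_div_alg.truncate C) v t = lattice_div_eval C v t" for v t
    by (induction t) (simp_all add: lattice_div_alg.defs)
  moreover have "mult_div_eval (mult_div_alg.truncate C) v t = mult_div_eval C v t" for v t
    by (induction t) (simp_all add: mult_div_alg.defs)
  moreover have "div_eval (div_alg.truncate C) v t = div_eval C v t" for v t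
    by (induction t) (simp_all add: div_alg.defs)
  ultimately show
    "lattice_div_valid (lattice_div_alg.truncate C) s1 t1 \<longleftrightarrow> lattice_div_valid C s1 t1"
    "mult_div_valid (mult_div_alg.truncate C) s2 t2 \<longleftrightarrow> mult_div_valid C s2 t2"
    "div_valid (div_alg.truncate C) s3 t3 \<longleftrightarrow> div_valid C s3 t3"
    by (simp_all add: lattice_div_valid_def mult_div_valid_def div_valid_def
        lattice_div_alg.defs mult_div_alg.defs div_alg.defs)
qed

theorem theorem5p3:
  assumes "infinite (UNIV :: 'c set)"
    and "infinite (UNIV :: 'r set)"
    and "infinite (UNIV :: 's set)"
    and "infinite (UNIV :: 'b set)"
  shows
    "(\<forall>s t. (\<forall>A :: 'c pointed_lattice_div_alg. casari_algebra A \<longrightarrow> lattice_div_valid A s t) \<longleftrightarrow>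
            (\<forall>B :: 'r lattice_div_alg.
               comm_integrally_closed_residuated_lattice B \<longrightarrow> lattice_div_valid B s t)) \<and>
     (\<forall>s t. (\<forall>A :: 'c pointed_lattice_div_alg. casari_algebra A \<longrightarrow> mult_div_valid A s t) \<longleftrightarrow>
            (\<forall>B :: 's mult_div_alg. sircomonoid B \<longrightarrow> mult_div_valid B s t)) \<and>
     (\<forall>s t. (\<forall>A :: 'c pointed_lattice_div_alg. casari_algebra A \<longrightarrow> div_valid A s t) \<longleftrightarrow>
            (\<forall>B :: 'b div_alg. bci_algebra B \<longrightarrow> div_valid B s t))"
proof (intro conjI allI iffI impI)
  fix s t and B :: "'r lattice_div_alg"
  assume "\<forall>A :: 'c pointed_lattice_div_alg. casari_algebra A \<longrightarrow> lattice_div_valid A s t"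
    "comm_integrally_closed_residuated_lattice B"
  \<comment> \<open>A failure in \<open>B\<close> gives a Casari counterexample on sets of pairs of
    multisets of terms, which is then moved into \<open>'c\<close>.\<close>
  then show "lattice_div_valid B s t"
    using lattice_frame_counterexample casari_transfer_valid(3)[OF _ assms(1)] by metis
next
  fix s t and A :: "'c pointed_lattice_div_alg"
  assume "\<forall>B :: 'r lattice_div_alg. comm_integrally_closed_residuated_lattice B \<longrightarrow> lattice_div_valid B s t"
    "casari_algebra A"
  \<comment> \<open>A failure in \<open>A\<close> is first moved to a Casari algebra on
    \<open>'r\<close>, and then to its reduct.\<close>
  then show "lattice_div_valid A s t"
    using casari_transfer_valid(3)[OF _ assms(2)] casari_lattice_reduct truncate_valid(1) by metis
next
  fix s t and B :: "'s mult_div_alg"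
  assume "\<forall>A :: 'c pointed_lattice_div_alg. casari_algebra A \<longrightarrow> mult_div_valid A s t" "sircomonoid B"
  then show "mult_div_valid B s t"
    using mult_div_frame_counterexample casari_transfer_valid(2)[OF _ assms(1)] by metis
next
  fix s t and A :: "'c pointed_lattice_div_alg"
  assume "\<forall>B :: 's mult_div_alg. sircomonoid B \<longrightarrow> mult_div_valid B s t" "casari_algebra A"
  then show "mult_div_valid A s t"
    using casari_transfer_valid(2)[OF _ assms(3)] casari_mult_div_reduct truncate_valid(2) by metis
next
  fix s t and B :: "'b div_alg"
  assume "\<forall>A :: 'c pointed_lattice_div_alg. casari_algebra A \<longrightarrow> div_valid A s t" "bci_algebra B"
  then show "div_valid B s t"
    using div_frame_counterexample casari_transfer_valid(1)[OF _ assms(1)] by metis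
next
  fix s t and A :: "'c pointed_lattice_div_alg"
  assume "\<forall>B :: 'b div_alg. bci_algebra B \<longrightarrow> div_valid B s t" "casari_algebra A"
  then show "div_valid A s t"
    using casari_transfer_valid(1)[OF _ assms(4)] casari_div_reduct truncate_valid(3) by metis
qed

end
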